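(* Let $J$ be a strongly non-nilpotent complex structure on an $8$-dimensional nilpotent Lie algebra $\mathfrak g$ such that $\dim\mathfrak g_1=1$ and $\dim\mathfrak g_2=3$. Then the pair $(\mathfrak g,J)$ is parametrized as follows: there is a $(1,0)$-basis $\{\omega^1,\omega^2,\omega^3,\omega^4\}$ satisfying the structure equations $$\begin{aligned} d\omega^1 &= 0,\\ d\omega^2 &= A\,\omega^{1\bar 1} -B(\omega^{14}- \omega^{1\bar 4}),\\ d\omega^3 &= (C-D)\,\omega^{12}-E\,(\omega^{14}- \omega^{1\bar 4})+F\,\omega^{1\bar 1}+(G+D)\,\omega^{1\bar 2}-H\,(\omega^{24}-\omega^{2\bar 4})+(C-G)\,\omega^{2\bar 1}+K\,\omega^{2\bar 2},\\ d\omega^4 &= L\,\omega^{1\bar 1}+M\,\omega^{1\bar 2}+N\,\omega^{1\bar 3}-\bar{M}\,\omega^{2\bar 1}+i\,s\,\omega^{2\bar 2}+P\,\omega^{2\bar 3}-\bar{N}\,\omega^{3\bar 1}-\bar{P}\,\omega^{3\bar 2}, \end{aligned}$$ where $A,B,C,D,E,F,G,H,K,L,M,N,P\in\mathbb C$ and $s\in\mathbb R$ satisfy the Jacobi identity (equivalently, $d^2=0$). Moreover, in these equations: (i) if $\mathfrak g$ has ascending type $(1,3,8)$, then $A=B=0$ and $\operatorname{Re} L=0$; (ii) if $\mathfrak g$ has ascending type $(1,3,6,8)$, then $B=H=K=P=0$; (iii) if $\mathfrak g$ has ascending type $(1,3,5,8)$, then $K=P=0$ and $\operatorname{Re} L=0$;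 (iv) if $\mathfrak g$ has ascending type $(1,3,5,6,8)$, then $H=K=P=s=0$ and $\operatorname{Re} L\neq 0$.
   Context: Lie algebras are real and finite-dimensional. The ascending central series of $\mathfrak g$ is $\mathfrak g_0=\{0\}$, $\mathfrak g_k=\{X\in\mathfrak g \mid [X,\mathfrak g]\subseteq \mathfrak g_{k-1}\}$ for $k\geq 1$. For nilpotent $\mathfrak g$, the nilpotency step $r$ is the smallest integer $r\ge1$ with $\mathfrak g_r=\mathfrak g$, and the ascending type of $\mathfrak g$ is $(\dim\mathfrak g_1,\ldots,\dim\mathfrak g_r)$. A complex structure on $\mathfrak g$ is a linear endomorphism $J$ with $J^2=-\mathrm{Id}$ and $[X,Y]+J[JX,Y]+J[X,JY]-[JX,JY]=0$ for all $X,Y\in\mathfrak g$. Let $\mathfrak a_1(J)=\{X\in\mathfrak g \mid [X,\mathfrak g]=0 \text{ and } [JX,\mathfrak g]=0\}$. $J$ is strongly non-nilpotent (SnN) if $\mathfrak a_1(J)=\{0\}$. The differential of $e\in\mathfrak g^*$ is $de(X,Y)=-e([X,Y])$, extended complex-linearly to $\mathfrak g^*_{\mathbb C}=\mathfrak g^*\otimes\mathbb C$. A $(1,0)$-basis is a basis of the space of $(1,0)$-forms with respect to $J$; the paper's convention is that if $\{X_k,JX_k\}_{k=1}^4$ is a basis of $\mathfrak g$ with dual basis $\{x^k,y^k\}_{k=1}^4$ ($x^k$ dual to $X_k$, $y^k$ dual to $JX_k$), then the forms $x^k-i\,y^k$ are of type $(1,0)$, i.e. $(1,0)$-forms are the $\omega\in\mathfrak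 g^*_{\mathbb C}$ with $\omega(JX)=-i\,\omega(X)$ for all $X\in\mathfrak g$. Notation: $\omega^{jk}=\omega^j\wedge\omega^k$ and $\omega^{j\bar k}=\omega^j\wedge\overline{\omega^k}$. *)

theory Defs
  imports "HOL-Analysis.Analysis" "HOL-Library.Function_Algebras"
begin

section \<open>Lie algebras and the ascending central series\<close>

text \<open>The underlying real vector space is a type of class \<open>real_vector\<close>; the bracket is a function
  on it. Finite dimension comes from hypotheses such as \<open>dim UNIV = 8\<close> (the library's \<open>dim\<close> is
  \<open>0\<close> on infinite-dimensional spaces).\<close>

definition lie_algebra :: "('a::real_vector \<Rightarrow> 'a \<Rightarrow> 'a) \<Rightarrow> bool" where
  "lie_algebra br \<longleftrightarrow>
     bilinear br \<and> (\<forall>X. br X X = 0) \<and>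
     (\<forall>X Y Z. br X (br Y Z) + br Y (br Z X) + br Z (br X Y) = 0)"

primrec asc_series :: "('a::real_vector \<Rightarrow> 'a \<Rightarrow> 'a) \<Rightarrow> nat \<Rightarrow> 'a set" where
  "asc_series br 0 = {0}"
| "asc_series br (Suc k) = {X. \<forall>Y. br X Y \<in> asc_series br k}"

definition nilpotent_lie :: "('a::real_vector \<Rightarrow> 'a \<Rightarrow> 'a) \<Rightarrow> bool" where
  "nilpotent_lie br \<longleftrightarrow> (\<exists>k. asc_series br k = UNIV)"

definition nil_step :: "('a::real_vector \<Rightarrow> 'a \<Rightarrow> 'a) \<Rightarrow> nat" where
  "nil_step br = (LEAST r. 1 \<le> r \<and> asc_series br r = UNIV)"

definition ascending_type :: "('a::real_vector \<Rightarrow> 'a \<Rightarrow> 'a) \<Rightarrow> nat list" where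
  "ascending_type br = map (\<lambda>k. dim (asc_series br k)) [1..<Suc (nil_step br)]"


section \<open>Complex structures\<close>

definition complex_structure ::
    "('a::real_vector \<Rightarrow> 'a \<Rightarrow> 'a) \<Rightarrow> ('a \<Rightarrow> 'a) \<Rightarrow> bool" where
  "complex_structure br J \<longleftrightarrow>
     linear J \<and> (\<forall>X. J (J X) = - X) \<and>
     (\<forall>X Y. br X Y + J (br (J X) Y) + J (br X (J Y)) - br (J X) (J Y) = 0)"

definition a1 :: "('a::real_vector \<Rightarrow> 'a \<Rightarrow> 'a) \<Rightarrow> ('a \<Rightarrow> 'a) \<Rightarrow> 'a set" where
  "a1 br J = {X. (\<forall>Y. br X Y = 0) \<and> (\<forall>Y. br (J X) Y = 0)}"

definition SnN :: "('a::real_vector \<Rightarrow> 'a \<Rightarrow> 'a) \<Rightarrow> ('a \<Rightarrow> 'a) \<Rightarrow> bool" where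
  "SnN br J \<longleftrightarrow> complex_structure br J \<and> a1 br J = {0}"


section \<open>Complex-valued forms\<close>

text \<open>The complexified dual is represented by the real-linear maps from the Lie algebra to
  \<open>complex\<close>, on which complex scalars act pointwise. A complex 2-form is represented by its values
  on pairs of real vectors, which determine it.\<close>

definition cscale :: "complex \<Rightarrow> ('a \<Rightarrow> complex) \<Rightarrow> 'a \<Rightarrow> complex" where
  "cscale c \<omega> = (\<lambda>X. c * \<omega> X)"

interpretation cform: vector_space "cscale :: complex \<Rightarrow> ('a \<Rightarrow> complex) \<Rightarrow> 'a \<Rightarrow> complex"
  by unfold_locales (auto simp: cscale_def fun_eq_iff algebra_simps)

definition cbar :: "('a \<Rightarrow> complex) \<Rightarrow> 'a \<Rightarrow> complex" where
  "cbar \<omega> = (\<lambda>X. cnj (\<omega> X))"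

definition wedge :: "('a \<Rightarrow> complex) \<Rightarrow> ('a \<Rightarrow> complex) \<Rightarrow> 'a \<Rightarrow> 'a \<Rightarrow> complex"
    (infixl "\<^bold>\<and>" 70) where
  "\<alpha> \<^bold>\<and> \<beta> = (\<lambda>X Y. \<alpha> X * \<beta> Y - \<alpha> Y * \<beta> X)"

definition d1 :: "('a::real_vector \<Rightarrow> 'a \<Rightarrow> 'a) \<Rightarrow> ('a \<Rightarrow> complex) \<Rightarrow> 'a \<Rightarrow> 'a \<Rightarrow> complex" where
  "d1 br \<omega> = (\<lambda>X Y. - \<omega> (br X Y))"

text \<open>The extension of \<open>d1\<close> to 2-forms as an antiderivation of the exterior algebra
  (Chevalley--Eilenberg formula).\<close>

definition d2 ::
    "('a::real_vector \<Rightarrow> 'a \<Rightarrow> 'a) \<Rightarrow> ('a \<Rightarrow> 'a \<Rightarrow> complex) \<Rightarrow> 'a \<Rightarrow> 'a \<Rightarrow> 'a \<Rightarrow> complex" where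
  "d2 br \<beta> = (\<lambda>X Y Z. - \<beta> (br X Y) Z + \<beta> (br X Z) Y - \<beta> (br Y Z) X)"

text \<open>The sign convention is that \<open>x - \<i> y\<close> is of type (1,0) when \<open>x\<close>, \<open>y\<close> are dual to \<open>X\<close>, \<open>J X\<close>.\<close>

definition forms10 :: "('a::real_vector \<Rightarrow> 'a) \<Rightarrow> ('a \<Rightarrow> complex) set" where
  "forms10 J = {\<omega>. linear \<omega> \<and> (\<forall>X. \<omega> (J X) = - \<i> * \<omega> X)}"

definition basis10 ::
    "('a::real_vector \<Rightarrow> 'a) \<Rightarrow> ('a \<Rightarrow> complex) \<Rightarrow> ('a \<Rightarrow> complex) \<Rightarrow>
     ('a \<Rightarrow> complex) \<Rightarrow> ('a \<Rightarrow> complex) \<Rightarrow> bool" where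
  "basis10 J \<omega>1 \<omega>2 \<omega>3 \<omega>4 \<longleftrightarrow>
     distinct [\<omega>1, \<omega>2, \<omega>3, \<omega>4] \<and>
     cform.independent {\<omega>1, \<omega>2, \<omega>3, \<omega>4} \<and>
     cform.span {\<omega>1, \<omega>2, \<omega>3, \<omega>4} = forms10 J"


section \<open>The structure equations\<close>

definition structure_equations ::
    "('a::real_vector \<Rightarrow> 'a \<Rightarrow> 'a) \<Rightarrow>
     ('a \<Rightarrow> complex) \<Rightarrow> ('a \<Rightarrow> complex) \<Rightarrow> ('a \<Rightarrow> complex) \<Rightarrow> ('a \<Rightarrow> complex) \<Rightarrow>
     complex \<Rightarrow> complex \<Rightarrow> complex \<Rightarrow> complex \<Rightarrow> complex \<Rightarrow> complex \<Rightarrow> complex \<Rightarrow>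
     complex \<Rightarrow> complex \<Rightarrow> complex \<Rightarrow> complex \<Rightarrow> complex \<Rightarrow> complex \<Rightarrow> real \<Rightarrow> bool" where
  "structure_equations br \<omega>1 \<omega>2 \<omega>3 \<omega>4 A B C D E F G H K L M N P s \<longleftrightarrow> (\<forall>X Y.
     d1 br \<omega>1 X Y = 0 \<and>
     d1 br \<omega>2 X Y = A * (\<omega>1 \<^bold>\<and> cbar \<omega>1) X Y
       - B * ((\<omega>1 \<^bold>\<and> \<omega>4) X Y - (\<omega>1 \<^bold>\<and> cbar \<omega>4) X Y) \<and>
     d1 br \<omega>3 X Y = (C - D) * (\<omega>1 \<^bold>\<and> \<omega>2) X Y
       - E * ((\<omega>1 \<^bold>\<and> \<omega>4) X Y - (\<omega>1 \<^bold>\<and> cbar \<omega>4) X Y)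
       + F * (\<omega>1 \<^bold>\<and> cbar \<omega>1) X Y
       + (G + D) * (\<omega>1 \<^bold>\<and> cbar \<omega>2) X Y
       - H * ((\<omega>2 \<^bold>\<and> \<omega>4) X Y - (\<omega>2 \<^bold>\<and> cbar \<omega>4) X Y)
       + (C - G) * (\<omega>2 \<^bold>\<and> cbar \<omega>1) X Y
       + K * (\<omega>2 \<^bold>\<and> cbar \<omega>2) X Y \<and>
     d1 br \<omega>4 X Y = L * (\<omega>1 \<^bold>\<and> cbar \<omega>1) X Y
       + M * (\<omega>1 \<^bold>\<and> cbar \<omega>2) X Y
       + N * (\<omega>1 \<^bold>\<and> cbar \<omega>3) X Y
       - cnj M * (\<omega>2 \<^bold>\<and> cbar \<omega>1) X Y
       + \<i> * of_real s * (\<omega>2 \<^bold>\<and> cbar \<omega>2) X Y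
       + P * (\<omega>2 \<^bold>\<and> cbar \<omega>3) X Y
       - cnj N * (\<omega>3 \<^bold>\<and> cbar \<omega>1) X Y
       - cnj P * (\<omega>3 \<^bold>\<and> cbar \<omega>2) X Y)"

end

theory Submission
  imports Defs
begin

text \<open>Let \<open>Z\<close> span the centre \<open>g 1\<close> and put \<open>T = ad (J Z)\<close>. As \<open>Z\<close> is central, integrability of \<open>J\<close> says
that \<open>T\<close> commutes with \<open>J\<close>; strong non-nilpotency says \<open>T \<noteq> 0\<close>. An element \<open>W\<close> of \<open>g 2\<close> has all its
brackets in \<open>\<real> Z\<close>, hence commutes with all brackets; this gives \<open>T W = 0\<close> and \<open>J Z \<notin> g 2\<close>.

For the existence of the basis, the crucial point is that \<open>g 2\<close> contains a complex line
(\<open>g2_meets_J_g2\<close>). If it did not, the complex span of \<open>g 2\<close> would be the kernel of \<open>T\<close>, of complex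
codimension one; a closed (1,0)-form (\<open>closed_form10\<close>) puts all brackets into this kernel, the image
of \<open>T\<close> is a complex line that commutes with it, and the action of the algebra on that line is so
restricted by integrability and nilpotency that one obtains a contradiction. So \<open>g 2\<close> is spanned by
\<open>X\<close>, \<open>J X\<close>, \<open>Z\<close>. Let \<open>M\<close> be the complex span of \<open>X\<close> and \<open>Z\<close>. There are two cases.
If \<open>T\<close> maps into \<open>M\<close> (\<open>adapted_T_into_M\<close>), its image is the line of \<open>X\<close>, so \<open>T\<close> is a complex
functional; it vanishes on all brackets, and its kernel brackets into \<open>g 2\<close>.
If not (\<open>adapted_T_not_into_M\<close>), Engel's argument yields \<open>V1\<close> such that \<open>V2 = T V1\<close> lies outside
\<open>g 2\<close> and brackets into \<open>g 2\<close>. In both cases one arrives at a complex basis \<open>V1\<close>, \<open>V2\<close>, \<open>X\<close>, \<open>Z\<close>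
with the bracket relations collected in \<open>adapted\<close>, and the dual basis of (1,0)-forms satisfies the
structure equations (\<open>structure_equations_of_adapted\<close>): \<open>\<omega>1\<close> is closed because brackets have no
\<open>V1\<close>-component, \<open>\<omega>3\<close> enters only \<open>d \<omega>4\<close> because \<open>X\<close> and \<open>J X\<close> bracket into \<open>\<real> Z\<close>, \<open>\<omega>4\<close> enters only
through its imaginary part because \<open>Z\<close> is central, and the coefficients of \<open>d \<omega>4\<close> are
skew-Hermitian, except for \<open>L\<close>, because only \<open>[V1, J V1]\<close> can have a \<open>J Z\<close>-component.

For the four ascending types, any basis satisfying the equations identifies the algebra with \<open>\<complex>\<^sup>4\<close>.
In these coordinates \<open>g 2\<close> is given by \<open>\<omega>1 = \<omega>2 = Im \<omega>4 = 0\<close>, so that \<open>g 3\<close> depends on \<open>A\<close>, \<open>B\<close> and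
\<open>Re L\<close> alone: it has dimension at most five if \<open>B \<noteq> 0\<close> and at least six otherwise. The Jacobi identity
gives \<open>P \<omega>2 = 0\<close> on brackets and the relations \<open>relation_HL\<close>, \<open>relation_NK\<close>, \<open>relation_NH\<close>. Finally
\<open>N\<close> and \<open>P\<close> are not both zero, for otherwise the \<open>\<omega>3\<close>-direction would be central, and \<open>B\<close>, \<open>E\<close>, \<open>H\<close>
are not all zero, for otherwise \<open>J Z\<close> would be central. All vanishing assertions follow.\<close>

section \<open>Linear algebra over the reals\<close>

lemma independent_image_of_Basis:
  fixes f :: "'b::euclidean_space \<Rightarrow> 'a::real_vector"
  assumes f: "linear f" and inj: "\<And>x. f x = 0 \<Longrightarrow> x = 0"
  shows "independent (f ` Basis)" "card (f ` Basis) = DIM('b)"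
proof -
  have "inj f" using f inj by (simp add: linear_injective_0)
  then have inj_Basis: "inj_on f S" for S by (meson inj_on_subset subset_UNIV)
  show "independent (f ` Basis)"
    by (rule linear_independent_injective_image[OF f independent_Basis inj_Basis])
  show "card (f ` Basis) = DIM('b)" by (rule card_image[OF inj_Basis])
qed

lemma dim_ge_of_injective:
  fixes f :: "'b::euclidean_space \<Rightarrow> 'a::real_vector"
  assumes f: "linear f" and inj: "\<And>x. f x = 0 \<Longrightarrow> x = 0"
    and sub: "range f \<subseteq> S" and d: "dim S > 0"
  shows "DIM('b) \<le> dim S"
proof -
  obtain C where C: "C \<subseteq> S" "independent C" "S \<subseteq> span C" "card C = dim S"
    by (rule basis_exists[of S])
  have "finite C" using C(4) d by (simp add: card_ge_0_finite)
  moreover have "f ` Basis \<subseteq> span C" using sub C by blast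
  ultimately have "card (f ` Basis) \<le> card C"
    using independent_span_bound independent_image_of_Basis(1)[OF f inj] by blast
  then show ?thesis using independent_image_of_Basis(2)[OF f inj] C(4) by simp
qed

lemma linear_injective_onto_subspace:
  fixes f :: "'b::euclidean_space \<Rightarrow> 'a::real_vector"
  assumes f: "linear f" and inj: "\<And>x. f x = 0 \<Longrightarrow> x = 0"
    and S: "subspace S" and sub: "range f \<subseteq> S" and d: "dim S = DIM('b)"
  shows "S \<subseteq> range f"
proof (rule ccontr)
  assume "\<not> S \<subseteq> range f"
  then obtain v where v: "v \<in> S" "v \<notin> range f" by blast
  let ?B = "f ` Basis"
  have spanB: "span ?B = range f" using f by (metis linear_span_image span_Basis)
  obtain C where C: "C \<subseteq> S" "independent C" "S \<subseteq> span C" "card C = dim S"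
    by (rule basis_exists[of S])
  have finC: "finite C" using C(4) d by (metis DIM_positive card.infinite less_irrefl)
  have "independent (insert v ?B)"
    using independent_image_of_Basis(1)[OF f inj] v spanB by (simp add: independent_insertI)
  moreover have "insert v ?B \<subseteq> span C" using v sub C by blast
  ultimately have "card (insert v ?B) \<le> card C"
    using independent_span_bound[OF finC] by blast
  moreover have "v \<notin> ?B" using v by blast
  ultimately show False using independent_image_of_Basis(2)[OF f inj] C d by simp
qed

lemma dim_le_of_linear_image:
  fixes f :: "'b::euclidean_space \<Rightarrow> 'a::real_vector"
  assumes f: "linear f" and sub: "S \<subseteq> range f"
  shows "dim S \<le> DIM('b)"
proof -
  have "span (f ` Basis) = range f" using f by (metis linear_span_image span_Basis)
  then have "dim S \<le> card (f ` Basis)" using sub by (intro dim_le_card) auto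
  also have "\<dots> \<le> DIM('b)" by (simp add: card_image_le)
  finally show ?thesis .
qed

lemma separating_functional:
  fixes S :: "'a::real_vector set"
  assumes S: "subspace S" and v: "v \<notin> S"
  obtains f :: "'a \<Rightarrow> real" where "linear f" "f v = 1" "\<And>x. x \<in> S \<Longrightarrow> f x = 0"
proof -
  obtain B where B: "B \<subseteq> S" "independent B" "S \<subseteq> span B"
    by (rule basis_exists[of S])
  have sp: "span B = S" using span_minimal[OF B(1) S] B(3) by (rule subset_antisym)
  have "independent (insert v B)" using B v sp by (simp add: independent_insertI)
  then obtain f :: "'a \<Rightarrow> real" where f: "linear f" "\<forall>x\<in>insert v B. f x = (if x = v then 1 else 0)"
    using linear_independent_extend[where f = "\<lambda>x. if x = v then 1 else 0"] by metis
  have "f x = 0" if "x \<in> S" for x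
  proof (rule linear_eq_0_on_span[OF f(1)])
    show "x \<in> span B" using that sp by simp
    fix b assume "b \<in> B"
    then show "f b = 0" using f(2) B(1) v by (metis insertCI subsetD)
  qed
  moreover have "f v = 1" using f(2) by simp
  ultimately show ?thesis using that f(1) by blast
qed

section \<open>Engel arguments in nilpotent Lie algebras\<close>

locale nilpotent_lie_algebra =
  fixes br :: "'a::real_vector \<Rightarrow> 'a \<Rightarrow> 'a"
  assumes lie: "lie_algebra br" and nilpotent: "nilpotent_lie br"
begin

lemma bil: "bilinear br" using lie by (simp add: lie_algebra_def)

lemmas br_simps =
  bilinear_ladd[OF bil] bilinear_radd[OF bil] bilinear_lmul[OF bil] bilinear_rmul[OF bil]
  bilinear_lneg[OF bil] bilinear_rneg[OF bil] bilinear_lsub[OF bil] bilinear_rsub[OF bil]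
  bilinear_lzero[OF bil] bilinear_rzero[OF bil]

lemma br_self [simp]: "br X X = 0" using lie by (simp add: lie_algebra_def)

lemma br_anti: "br X Y = - br Y X"
proof -
  have "br (X + Y) (X + Y) = br X X + br X Y + (br Y X + br Y Y)"
    by (simp only: br_simps ac_simps)
  then show ?thesis by (simp add: eq_neg_iff_add_eq_0)
qed

lemma jacobi: "br X (br Y Z) + br Y (br Z X) + br Z (br X Y) = 0"
  using lie by (simp add: lie_algebra_def)

lemma br_derivation: "br X (br Y Z) = br (br X Y) Z + br Y (br X Z)"
  using jacobi[of X Y Z] br_anti[of Z X] br_anti[of Z "br X Y"]
  by (simp add: br_simps algebra_simps)

abbreviation g :: "nat \<Rightarrow> 'a set" where "g k \<equiv> asc_series br k"

lemma g_subspace: "subspace (g k)"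
  by (induction k) (auto simp: subspace_def br_simps)

lemmas g_closed = subspace_0[OF g_subspace] subspace_add[OF g_subspace]
  subspace_diff[OF g_subspace] subspace_scale[OF g_subspace] subspace_neg[OF g_subspace]

lemma g_Suc: "X \<in> g (Suc k) \<longleftrightarrow> (\<forall>Y. br X Y \<in> g k)" by simp

lemma g1_iff: "X \<in> g 1 \<longleftrightarrow> (\<forall>Y. br X Y = 0)"
  by simp

lemma g2_iff: "X \<in> g 2 \<longleftrightarrow> (\<forall>Y. br X Y \<in> g 1)"
  by (simp add: numeral_2_eq_2)

lemma g_mono_Suc: "g k \<subseteq> g (Suc k)"
proof (induction k)
  case (Suc k)
  then show ?case unfolding asc_series.simps(2)[of br "Suc k"] using g_Suc by blast
qed (auto simp: br_simps)

lemma g_mono: "j \<le> k \<Longrightarrow> g j \<subseteq> g k"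
  using lift_Suc_mono_le[of g j k] g_mono_Suc by blast

lemma g_top: obtains r where "g r = UNIV"
  using nilpotent by (auto simp: nilpotent_lie_def)

lemma g_least:
  assumes "\<exists>v\<in>B. v \<notin> A" and "0 \<in> A"
  obtains j where "\<exists>v\<in>B. v \<in> g (Suc j) \<and> v \<notin> A" and "\<And>v. v \<in> B \<Longrightarrow> v \<in> g j \<Longrightarrow> v \<in> A"
proof -
  define P where "P j \<longleftrightarrow> (\<exists>v\<in>B. v \<in> g j \<and> v \<notin> A)" for j
  obtain r where "g r = UNIV" by (rule g_top)
  then have "P r" using assms(1) by (auto simp: P_def)
  moreover have "\<not> P 0" using assms(2) by (auto simp: P_def)
  ultimately obtain j where "P (Suc j)" "\<not> P j"
    using dec_induct[of 0 r "\<lambda>j. \<not> P j"] by blast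
  then show ?thesis using that[of j] unfolding P_def by blast
qed

text \<open>An element of \<open>B\<close> that lies in the earliest possible term of the ascending series without lying
  in \<open>A\<close> has its brackets in \<open>B\<close> and in the preceding term, hence in \<open>A\<close>.\<close>

lemma engel:
  assumes B: "\<And>v Y. v \<in> B \<Longrightarrow> br v Y \<in> B" and "\<exists>v\<in>B. v \<notin> A" and "0 \<in> A"
  obtains v where "v \<in> B" "v \<notin> A" "\<And>Y. br v Y \<in> A"
  using g_least[OF assms(2,3)] B g_Suc by metis

text \<open>If \<open>B\<close> is contained in \<open>A + g (k+1)\<close> then its brackets lie in \<open>A + g k\<close>, and then so does \<open>B\<close>;
  descending from a term that is the whole algebra one reaches \<open>A + g 0\<close>. In other words, a
  nonzero quotient is never spanned by its own brackets.\<close>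

lemma engel_dual:
  assumes A: "subspace A" "\<And>X Y. X \<in> A \<Longrightarrow> br Y X \<in> A"
    and B: "B \<subseteq> span ({br Y b |Y b. b \<in> B} \<union> A)"
  shows "B \<subseteq> A"
proof -
  have step: "B \<subseteq> {a + x |a x. a \<in> A \<and> x \<in> g k}" (is "_ \<subseteq> ?S k")
    if prev: "B \<subseteq> {a + x |a x. a \<in> A \<and> x \<in> g (Suc k)}" for k
  proof -
    have sub: "subspace (?S k)" using subspace_sums[OF A(1) g_subspace] .
    have "{br Y b |Y b. b \<in> B} \<subseteq> ?S k"
    proof clarify
      fix Y b assume "b \<in> B"
      then obtain a x where b: "b = a + x" "a \<in> A" "x \<in> g (Suc k)" using prev by blast
      have "br Y x \<in> g k" using b(3) g_Suc br_anti[of Y x] g_closed(5) by metis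
      moreover have "br Y b = br Y a + br Y x" by (simp add: b br_simps)
      ultimately show "\<exists>a x. br Y b = a + x \<and> a \<in> A \<and> x \<in> g k" using b A(2) by blast
    qed
    moreover have "A \<subseteq> ?S k"
      using g_closed(1)[of k] by clarsimp (metis add.right_neutral)
    ultimately have "span ({br Y b |Y b. b \<in> B} \<union> A) \<subseteq> ?S k"
      by (intro span_minimal[OF _ sub] Un_least)
    with B show ?thesis by (rule order_trans)
  qed
  obtain r where r: "g r = UNIV" by (rule g_top)
  have "\<exists>a y. x = a + y \<and> a \<in> A \<and> y \<in> g r" for x
    using subspace_0[OF A(1)] r by (intro exI[of _ 0] exI[of _ x]) simp
  then have top: "B \<subseteq> ?S r" by simp
  have down: "B \<subseteq> ?S 0" if "B \<subseteq> ?S k" for k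
    using that
  proof (induction k)
    case (Suc k)
    show ?case by (rule Suc.IH[OF step[OF Suc.prems]])
  qed
  have "B \<subseteq> ?S 0" by (rule down[OF top])
  then show ?thesis by auto
qed

text \<open>An eigenvector of \<open>ad Y\<close> modulo \<open>A\<close> with eigenvalue \<open>c \<noteq> 0\<close> would descend the ascending series:
  from \<open>v \<in> A + g (k+1)\<close> follows \<open>c v \<in> A + g k\<close>.\<close>

lemma eigenvalue_zero:
  assumes A: "subspace A" "\<And>X. X \<in> A \<Longrightarrow> br Y X \<in> A"
    and v: "v \<notin> A" "br Y v - c *\<^sub>R v \<in> A"
  shows "c = 0"
proof (rule ccontr)
  assume c: "c \<noteq> 0"
  have step: "\<exists>a\<in>A. v - a \<in> g k" if prev: "\<exists>a\<in>A. v - a \<in> g (Suc k)" for k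
  proof -
    obtain a where a: "a \<in> A" "v - a \<in> g (Suc k)" using prev by blast
    have "br Y (v - a) \<in> g k" using a(2) g_Suc br_anti[of Y "v - a"] g_closed(5) by metis
    then have *: "(1 / c) *\<^sub>R br Y (v - a) \<in> g k" by (rule g_closed)
    let ?b = "- ((1 / c) *\<^sub>R ((br Y v - c *\<^sub>R v) - br Y a))"
    have "?b \<in> A" using A v a by (simp add: subspace_neg subspace_scale subspace_diff)
    moreover have "v - ?b = (1 / c) *\<^sub>R br Y (v - a)" using c by (simp add: br_simps algebra_simps)
    ultimately show ?thesis using * by metis
  qed
  obtain r where r: "g r = UNIV" by (rule g_top)
  have "\<exists>a\<in>A. v - a \<in> g r" using subspace_0[OF A(1)] r by blast
  moreover have "\<exists>a\<in>A. v - a \<in> g 0" if "\<exists>a\<in>A. v - a \<in> g k" for k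
    using that
  proof (induction k)
    case (Suc k)
    show ?case by (rule Suc.IH[OF step[OF Suc.prems]])
  qed
  ultimately have "\<exists>a\<in>A. v - a \<in> g 0" by metis
  then show False using v by auto
qed

end

section \<open>Complex structures and closed forms of type (1,0)\<close>

text \<open>Multiplication by complex numbers in which the imaginary unit acts as \<open>- J\<close>: this choice makes the
  (1,0)-forms exactly the complex-linear functionals.\<close>

definition act :: "('a::real_vector \<Rightarrow> 'a) \<Rightarrow> complex \<Rightarrow> 'a \<Rightarrow> 'a" where
  "act J c X = Re c *\<^sub>R X - Im c *\<^sub>R J X"

locale nilpotent_complex_lie_algebra = nilpotent_lie_algebra +
  fixes J :: "'a \<Rightarrow> 'a"
  assumes cstr: "complex_structure br J"
begin

lemma linJ: "linear J" using cstr by (simp add: complex_structure_def)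

lemmas J_simps = linear_add[OF linJ] linear_diff[OF linJ] linear_neg[OF linJ]
  linear_scale[OF linJ] linear_0[OF linJ]

lemma JJ [simp]: "J (J X) = - X" using cstr by (simp add: complex_structure_def)

lemma J_eq_0 [simp]: "J X = 0 \<longleftrightarrow> X = 0"
  using JJ[of X] J_simps(5) by (metis neg_equal_0_iff_equal)

lemma nijenhuis: "br X Y + J (br (J X) Y) + J (br X (J Y)) - br (J X) (J Y) = 0"
  using cstr by (simp add: complex_structure_def)

abbreviation cmul :: "complex \<Rightarrow> 'a \<Rightarrow> 'a" (infixr "\<odot>" 75) where "c \<odot> X \<equiv> act J c X"

lemma act_add_left: "(c + d) \<odot> X = c \<odot> X + d \<odot> X"
  and act_add_right: "c \<odot> (X + Y) = c \<odot> X + c \<odot> Y"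
  and act_diff_left: "(c - d) \<odot> X = c \<odot> X - d \<odot> X"
  and act_mult: "c \<odot> (d \<odot> X) = (c * d) \<odot> X"
  and act_scaleR': "(of_real r * c) \<odot> X = r *\<^sub>R (c \<odot> X)"
  and J_act: "J (c \<odot> X) = c \<odot> J X"
  and act_minus_left: "(- c) \<odot> X = - (c \<odot> X)"
  and act_of_real: "of_real r \<odot> X = r *\<^sub>R X"
  and act_0 [simp]: "0 \<odot> X = 0" and act_zero [simp]: "c \<odot> 0 = 0"
  and act_1 [simp]: "1 \<odot> X = X"
  and act_i: "\<i> \<odot> X = - J X"
  by (simp_all add: act_def J_simps algebra_simps)

lemma J_as_act: "J X = (- \<i>) \<odot> X" by (simp add: act_def)

lemma act_eq_0_iff: "c \<odot> X = 0 \<longleftrightarrow> c = 0 \<or> X = 0"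
proof -
  have "X = 0" if "c \<noteq> 0" "c \<odot> X = 0"
    using act_mult[of "1 / c" c X] that by simp
  then show ?thesis by auto
qed

lemma forms10_D:
  assumes "\<omega> \<in> forms10 J"
  shows "linear \<omega>" "\<omega> (J X) = - \<i> * \<omega> X" "\<omega> (c \<odot> X) = c * \<omega> X"
proof -
  show l: "linear \<omega>" and i: "\<omega> (J X) = - \<i> * \<omega> X" for X using assms by (auto simp: forms10_def)
  show "\<omega> (c \<odot> X) = c * \<omega> X"
    by (simp add: act_def linear_diff[OF l] linear_scale[OF l] i complex_eq_iff)
qed

text \<open>A real functional is the negative of the imaginary part of exactly one (1,0)-form, so
  (1,0)-forms can be found by separating a vector from a real subspace.\<close>

lemma form10_of_functional:
  fixes f :: "'a \<Rightarrow> real"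
  assumes "linear f"
  shows "(\<lambda>X. Complex (f (J X)) (- f X)) \<in> forms10 J"
proof -
  have "linear (\<lambda>X. Complex (f (J X)) (- f X))"
    by (rule linearI) (simp_all add: linear_add[OF assms] linear_scale[OF assms] J_simps complex_eq_iff)
  then show ?thesis using linear_neg[OF assms] by (auto simp: forms10_def complex_eq_iff)
qed

text \<open>Take the last term \<open>g j\<close> with \<open>g j + J (g j)\<close> proper and a (1,0)-form \<open>\<omega>\<close> vanishing on it. Then \<open>\<omega>\<close>
  kills the brackets of \<open>g (j+1)\<close> with everything, and by integrability also those of \<open>J (g (j+1))\<close>
  with itself. Since \<open>g (j+1) + J (g (j+1))\<close> is the whole algebra, \<open>\<omega>\<close> is closed.\<close>

lemma closed_form10:
  assumes "{x + J y |x y. x \<in> g k \<and> y \<in> g k} \<noteq> UNIV"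
  obtains \<omega> v where "\<omega> \<in> forms10 J" "\<omega> v \<noteq> 0" "\<And>X. X \<in> g k \<Longrightarrow> \<omega> X = 0" "\<And>X Y. \<omega> (br X Y) = 0"
proof -
  define C where "C j = {x + J y |x y. x \<in> g j \<and> y \<in> g j}" for j
  have Cmono: "C i \<subseteq> C j" if "i \<le> j" for i j
    using g_mono[OF that] unfolding C_def by blast
  have C1: "x \<in> C j" and C2: "J x \<in> C j" if "x \<in> g j" for x j
  proof -
    have "x + J 0 \<in> C j" "0 + J x \<in> C j" using that g_closed(1) unfolding C_def by blast+
    then show "x \<in> C j" "J x \<in> C j" by (simp_all add: J_simps)
  qed
  obtain r where r: "g r = UNIV" by (rule g_top)
  have "C r = UNIV" using C1 r by blast
  then have ex: "\<exists>j. C j = UNIV" by blast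
  define m where "m = (LEAST j. C j = UNIV)"
  have m: "C m = UNIV" unfolding m_def using ex by (rule LeastI_ex)
  have "\<not> m \<le> k"
  proof
    assume "m \<le> k"
    then have "C k = UNIV" using Cmono m by (metis top.extremum_uniqueI)
    then show False using assms by (simp add: C_def)
  qed
  then obtain j where j: "m = Suc j" "k \<le> j" by (cases m) auto
  have nj: "C j \<noteq> UNIV" using not_less_Least[of j "\<lambda>j. C j = UNIV"] j unfolding m_def by simp
  have "{x + y |x y. x \<in> g j \<and> y \<in> J ` g j} = C j" unfolding C_def by auto
  then have forms_linear: "subspace (C j)"
    using subspace_sums[OF g_subspace linear_subspace_image[OF linJ g_subspace], of j j] by simp
  obtain v where v: "v \<notin> C j" using nj by auto
  obtain f :: "'a \<Rightarrow> real" where f: "linear f" "f v = 1" "\<And>x. x \<in> C j \<Longrightarrow> f x = 0"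
    using separating_functional[OF forms_linear v] by metis
  define \<omega> where "\<omega> X = Complex (f (J X)) (- f X)" for X
  have w: "\<omega> \<in> forms10 J" unfolding \<omega>_def by (rule form10_of_functional[OF f(1)])
  note lw = forms10_D(1)[OF w] and Jw = forms10_D(2)[OF w]
  have w0: "\<omega> X = 0" if "X \<in> g j" for X
    using f(3)[OF C1[OF that]] f(3)[OF C2[OF that]] unfolding \<omega>_def by (simp add: complex_eq_iff)
  have br0: "\<omega> (br X Y) = 0" if "X \<in> g m" for X Y
    using that j g_Suc w0 by auto
  have br0': "\<omega> (br Y X) = 0" if "X \<in> g m" for X Y
    using br0[OF that, of Y] br_anti[of Y X] by (simp add: linear_neg[OF lw])
  have JJ0: "\<omega> (br (J X) (J Y)) = 0" if "X \<in> g m" "Y \<in> g m" for X Y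
  proof -
    have "\<omega> (br X Y + J (br (J X) Y) + J (br X (J Y)) - br (J X) (J Y)) = 0"
      by (simp add: nijenhuis linear_0[OF lw])
    then show ?thesis
      using br0[OF that(1)] br0'[OF that(2)] by (simp add: linear_add[OF lw] linear_diff[OF lw] Jw)
  qed
  have "\<omega> (br X Y) = 0" for X Y
  proof -
    obtain a b c d where "X = a + J b" "Y = c + J d" "a \<in> g m" "b \<in> g m" "c \<in> g m" "d \<in> g m"
      using m unfolding C_def by blast
    then show ?thesis
      by (simp add: br_simps linear_add[OF lw] br0 br0' JJ0)
  qed
  moreover have "\<omega> v \<noteq> 0" using f(2) unfolding \<omega>_def by (simp add: complex_eq_iff)
  moreover have "\<omega> X = 0" if "X \<in> g k" for X using w0 g_mono[OF j(2)] that by blast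
  ultimately show ?thesis using that w by blast
qed

end

section \<open>Strongly non-nilpotent complex structures in dimension eight\<close>

locale snn_eight = nilpotent_complex_lie_algebra +
  fixes Z :: 'a
  assumes dim8: "dim (UNIV :: 'a set) = 8"
    and snn: "a1 br J = {0}"
    and dim_g2: "dim (g 2) = 3"
    and Z: "Z \<noteq> 0" and g1: "g 1 = range (\<lambda>t. t *\<^sub>R Z)"
begin

lemma Z_central [simp]: "br Z Y = 0" "br Y Z = 0"
proof -
  have "1 *\<^sub>R Z \<in> g 1" unfolding g1 by (rule rangeI)
  then show "br Z Y = 0" unfolding g1_iff by simp
  then show "br Y Z = 0" using br_anti[of Y Z] by simp
qed

lemma scaleR_Z_in_g1: "t *\<^sub>R Z \<in> g 1" unfolding g1 by (rule rangeI)

lemma g1E: assumes "W \<in> g 1" obtains t where "W = t *\<^sub>R Z"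
  using assms unfolding g1 by blast

lemma g1_le_g2: "W \<in> g 1 \<Longrightarrow> W \<in> g 2"
  using g_mono[of 1 2] by auto

abbreviation T :: "'a \<Rightarrow> 'a" where "T Y \<equiv> br (J Z) Y"

text \<open>As \<open>Z\<close> is central, only two terms of the integrability condition for \<open>Z\<close> and \<open>Y\<close> survive.\<close>

lemma T_J: "T (J Y) = J (T Y)"
  using nijenhuis[of Z Y] by (simp add: br_simps J_simps)

lemma T_act: "T (c \<odot> Y) = c \<odot> T Y"
  by (simp add: act_def br_simps T_J)

lemma br_JZ: "br Y (J Z) = - T Y" by (rule br_anti)

lemma T_self [simp]: "T Z = 0" "T (J Z) = 0"
  by simp_all

lemma T_nontrivial: obtains V where "T V \<noteq> 0"
proof -
  have "Z \<notin> a1 br J" using snn Z by simp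
  then show ?thesis using that by (auto simp: a1_def)
qed

lemma JZ_notin_g1: "t *\<^sub>R J Z \<in> g 1 \<Longrightarrow> t = 0"
proof -
  assume *: "t *\<^sub>R J Z \<in> g 1"
  obtain V where "T V \<noteq> 0" by (rule T_nontrivial)
  then show "t = 0" using * unfolding g1_iff by (auto simp: br_simps)
qed

lemma J_g1_notin: "W \<in> g 1 \<Longrightarrow> J W \<in> g 1 \<Longrightarrow> W = 0"
  by (metis g1E JZ_notin_g1 J_simps(4) scaleR_zero_left)

text \<open>If \<open>J Z\<close> were in \<open>g 2\<close>, the image of \<open>T\<close> would be a \<open>J\<close>-invariant subspace of the real line of
  \<open>Z\<close>, hence zero.\<close>

lemma JZ_notin_g2: "t *\<^sub>R J Z \<in> g 2 \<Longrightarrow> t = 0"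
proof (rule ccontr)
  assume *: "t *\<^sub>R J Z \<in> g 2" and t: "t \<noteq> 0"
  have "(1/t) *\<^sub>R t *\<^sub>R J Z \<in> g 2" by (rule g_closed(4)[OF *])
  then have JZ: "J Z \<in> g 2" using t by simp
  have "T Y = 0" for Y
  proof (rule J_g1_notin)
    show "T Y \<in> g 1" using JZ unfolding g2_iff by blast
    show "J (T Y) \<in> g 1" using JZ unfolding g2_iff by (metis T_J)
  qed
  then show False using T_nontrivial by metis
qed

lemma g2E: assumes "W \<in> g 2" obtains t where "br W Y = t *\<^sub>R Z"
  using assms g2_iff g1E by metis

text \<open>By the Jacobi identity, since the brackets of \<open>W\<close> are central.\<close>

lemma g2_centralizes_derived: "W \<in> g 2 \<Longrightarrow> br W (br Y Y') = 0"
  by (metis g2E br_derivation Z_central add_0 bilinear_lmul[OF bil] bilinear_rmul[OF bil] scaleR_zero_right)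

text \<open>If \<open>[W, J Z] = t Z\<close>, then \<open>T (J W) = - t J Z\<close> is a bracket, so \<open>W\<close> commutes with it; but its bracket
  with \<open>W\<close> is \<open>- t\<^sup>2 Z\<close>.\<close>

lemma T_g2: "W \<in> g 2 \<Longrightarrow> T W = 0"
proof -
  assume W: "W \<in> g 2"
  obtain t where t: "br W (J Z) = t *\<^sub>R Z" using g2E[OF W] .
  have "T (J W) = - t *\<^sub>R J Z" using t br_JZ[of W] T_J[of W] by (metis J_simps(3,4) minus_minus scaleR_minus_left)
  moreover have "br W (T (J W)) = 0" by (rule g2_centralizes_derived[OF W])
  ultimately have "t *\<^sub>R t *\<^sub>R Z = 0" using t by (simp add: br_simps)
  then have "t = 0" using Z by simp
  then show "T W = 0" using t br_JZ[of W] by simp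
qed

text \<open>As \<open>T Y = - [Y, J Z]\<close>, otherwise \<open>J Z\<close> would be an eigenvector of \<open>ad Y\<close> modulo \<open>g 2\<close>.\<close>

lemma T_JZ_g2: "T Y - t *\<^sub>R J Z \<in> g 2 \<Longrightarrow> t = 0"
proof -
  assume "T Y - t *\<^sub>R J Z \<in> g 2"
  then have "- (T Y - t *\<^sub>R J Z) \<in> g 2" by (rule g_closed)
  moreover have "- (T Y - t *\<^sub>R J Z) = br Y (J Z) - (- t) *\<^sub>R J Z" by (simp add: br_JZ)
  ultimately have "br Y (J Z) - (- t) *\<^sub>R J Z \<in> g 2" by (simp only:)
  moreover have "br Y X \<in> g 2" if "X \<in> g 2" for X
    using that g2_iff g1_le_g2 br_anti[of Y X] g_closed(5) by metis
  moreover have "J Z \<notin> g 2" using JZ_notin_g2[of 1] by auto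
  ultimately have "- t = 0" by (intro eigenvalue_zero[OF g_subspace])
  then show "t = 0" by simp
qed

lemma g2_bracket: "W \<in> g 2 \<Longrightarrow> br W Y \<in> g 1" "W \<in> g 2 \<Longrightarrow> br Y W \<in> g 1"
  using g2_iff br_anti[of Y W] g_closed(5) by metis+

lemma g2_bracket': "W \<in> g 2 \<Longrightarrow> br W Y \<in> g 2" "W \<in> g 2 \<Longrightarrow> br Y W \<in> g 2"
  using g2_bracket g1_le_g2 by blast+

lemma complex_basis:
  assumes indep: "\<And>a b c d. a \<odot> V1 + b \<odot> V2 + c \<odot> V3 + d \<odot> V4 = 0 \<Longrightarrow> a = 0 \<and> b = 0 \<and> c = 0 \<and> d = 0"
  obtains a b c d where "Y = a \<odot> V1 + b \<odot> V2 + c \<odot> V3 + d \<odot> V4"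
proof -
  define f where "f = (\<lambda>(a, b, c, d). a \<odot> V1 + b \<odot> V2 + c \<odot> V3 + d \<odot> V4)"
  have "linear f"
    by (rule linearI) (auto simp: f_def act_def algebra_simps)
  moreover have "x = 0" if "f x = 0" for x
    using that indep unfolding f_def zero_prod_def by (auto split: prod.splits)
  ultimately have "UNIV \<subseteq> range f"
    by (intro linear_injective_onto_subspace) (auto simp: dim8 subspace_UNIV)
  then obtain x where "Y = f x" by blast
  then show ?thesis using that unfolding f_def by (auto split: prod.splits)
qed

lemma exists_outside_complex_span:
  obtains V where "\<And>a b c. V \<noteq> a \<odot> V1 + b \<odot> V2 + c \<odot> V3"
proof -
  define f where "f = (\<lambda>(a, b, c). a \<odot> V1 + b \<odot> V2 + c \<odot> V3)"
  have "linear f"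
    by (rule linearI) (auto simp: f_def act_def algebra_simps)
  then have "\<not> UNIV \<subseteq> range f" using dim_le_of_linear_image[of f UNIV] dim8 by auto
  then obtain V where V: "V \<notin> range f" by blast
  have "V \<noteq> a \<odot> V1 + b \<odot> V2 + c \<odot> V3" for a b c
  proof -
    have "f (a, b, c) = a \<odot> V1 + b \<odot> V2 + c \<odot> V3" by (simp add: f_def)
    with V show ?thesis by (metis rangeI)
  qed
  then show ?thesis by (rule that)
qed

lemma g2_basis:
  assumes "X \<in> g 2" "U \<in> g 2"
    and indep: "\<And>a b c. a *\<^sub>R X + b *\<^sub>R U + c *\<^sub>R Z = 0 \<Longrightarrow> a = 0 \<and> b = 0 \<and> c = 0"
    and "W \<in> g 2"
  obtains a b c where "W = a *\<^sub>R X + b *\<^sub>R U + c *\<^sub>R Z"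
proof -
  define f where "f = (\<lambda>(a, b, c). a *\<^sub>R X + b *\<^sub>R U + c *\<^sub>R Z)"
  have "linear f"
    by (rule linearI) (auto simp: f_def algebra_simps)
  moreover have "x = 0" if "f x = 0" for x
    using that indep unfolding f_def zero_prod_def by (auto split: prod.splits)
  moreover have "range f \<subseteq> g 2"
    using assms(1,2) scaleR_Z_in_g1 g1_le_g2 unfolding f_def by (auto intro!: g_closed)
  ultimately have "g 2 \<subseteq> range f"
    by (intro linear_injective_onto_subspace[OF _ _ g_subspace]) (auto simp: dim_g2)
  then obtain x where "W = f x" using assms(4) by blast
  then show ?thesis using that unfolding f_def by (auto split: prod.splits)
qed

lemma exists_in_g2_outside_span: obtains X where "X \<in> g 2" "\<And>a b. X \<noteq> a *\<^sub>R U + b *\<^sub>R Z"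
proof -
  define f where "f = (\<lambda>(a, b). a *\<^sub>R U + b *\<^sub>R Z)"
  have "linear f"
    by (rule linearI) (auto simp: f_def algebra_simps)
  then have "\<not> g 2 \<subseteq> range f" using dim_le_of_linear_image[of f "g 2"] dim_g2 by auto
  then obtain X where X: "X \<in> g 2" "X \<notin> range f" by blast
  have "X \<noteq> a *\<^sub>R U + b *\<^sub>R Z" for a b
  proof -
    have "f (a, b) = a *\<^sub>R U + b *\<^sub>R Z" by (simp add: f_def)
    with X(2) show ?thesis by (metis rangeI)
  qed
  with X(1) show ?thesis by (rule that)
qed

text \<open>Let \<open>B\<close> be the image of \<open>T\<close> plus \<open>g 2\<close> plus the line of \<open>J Z\<close>; by assumption it contains all
  brackets. Were \<open>J Z\<close> a component of a bracket of \<open>B\<close>, then, since \<open>T V = - [V, J Z]\<close>, all of \<open>B\<close> would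
  come from brackets of \<open>B\<close> modulo \<open>g 2\<close>, contrary to \<open>engel_dual\<close>.\<close>

lemma bracket_image_T:
  assumes D: "\<And>X Y. \<exists>V t. br X Y - T V - t *\<^sub>R J Z \<in> g 2"
  shows "\<exists>V'. br Y (T V) - T V' \<in> g 2"
proof -
  obtain V' t where V': "br Y (T V) - T V' - t *\<^sub>R J Z \<in> g 2" using D by blast
  have "t = 0"
  proof (rule ccontr)
    assume t: "t \<noteq> 0"
    define B where "B = {W. \<exists>V t. W - T V - t *\<^sub>R J Z \<in> g 2}"
    let ?C = "span ({br Y b |Y b. b \<in> B} \<union> g 2)"
    have JZ: "J Z \<in> B"
      unfolding B_def mem_Collect_eq by (rule exI[of _ 0], rule exI[of _ 1]) (simp add: g_closed(1) br_simps)
    have TB: "T W \<in> B" for W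
      unfolding B_def mem_Collect_eq by (rule exI[of _ W], rule exI[of _ 0]) (simp add: g_closed(1))
    have "br (- W) (J Z) \<in> ?C" for W using JZ by (intro span_base) blast
    then have TC: "T W \<in> ?C" for W by (simp add: br_simps br_JZ)
    have 1: "br Y (T V) \<in> ?C" using TB by (intro span_base) blast
    have 2: "br Y (T V) - T V' - t *\<^sub>R J Z \<in> ?C" using V' by (intro span_base) blast
    have "(1/t) *\<^sub>R (br Y (T V) - T V' - (br Y (T V) - T V' - t *\<^sub>R J Z)) \<in> ?C"
      by (rule span_scale[OF span_diff[OF span_diff[OF 1 TC] 2]])
    then have JZC: "J Z \<in> ?C" using t by simp
    have "B \<subseteq> ?C"
    proof
      fix W assume "W \<in> B"
      then obtain V t where "W - T V - t *\<^sub>R J Z \<in> g 2" unfolding B_def by blast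
      then have "(W - T V - t *\<^sub>R J Z) + T V + t *\<^sub>R J Z \<in> ?C"
        using TC JZC by (intro span_add span_scale) (auto intro: span_base)
      then show "W \<in> ?C" by simp
    qed
    then have "B \<subseteq> g 2" using g2_bracket' by (intro engel_dual[OF g_subspace]) auto
    then show False using JZ JZ_notin_g2[of 1] by auto
  qed
  then show ?thesis using V' by auto
qed

text \<open>By \<open>bracket_image_T\<close>, the image of \<open>T\<close> plus \<open>g 2\<close> is an ideal, so \<open>engel\<close> applies to it.\<close>

lemma exists_image_T_in_g3:
  assumes D: "\<And>X Y. \<exists>V t. br X Y - T V - t *\<^sub>R J Z \<in> g 2"
    and V: "T V \<notin> g 2"
  obtains V' where "T V' \<notin> g 2" "\<And>Y. br (T V') Y \<in> g 2"
proof -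
  define B where "B = {W. \<exists>V. W - T V \<in> g 2}"
  have "br W Y \<in> B" if W: "W \<in> B" for W Y
  proof -
    obtain V where V: "W - T V \<in> g 2" using W unfolding B_def by blast
    obtain V' where V': "br Y (T V) - T V' \<in> g 2" using bracket_image_T[OF D, of Y V] by metis
    have "br (W - T V) Y - (br Y (T V) - T V') \<in> g 2"
      by (rule g_closed(3)[OF g2_bracket'(1)[OF V] V'])
    moreover have "br (W - T V) Y - (br Y (T V) - T V') = br W Y - T (- V')"
      using br_anti[of "T V" Y] by (simp add: br_simps)
    ultimately show ?thesis unfolding B_def by auto
  qed
  moreover have "T V \<in> B"
    unfolding B_def mem_Collect_eq by (rule exI[of _ V]) (simp add: g_closed(1))
  ultimately obtain v where v: "v \<in> B" "v \<notin> g 2" "\<And>Y. br v Y \<in> g 2"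
    using engel[of B "g 2"] V g_closed(1)[of 2] by metis
  obtain V' where V': "v - T V' \<in> g 2" using v(1) unfolding B_def by blast
  have "T V' \<notin> g 2" using v(2) V' g_closed(2)[of "v - T V'" 2 "T V'"] by auto
  moreover have "br (T V') Y \<in> g 2" for Y
  proof -
    have "br v Y - br (v - T V') Y \<in> g 2" by (rule g_closed(3)[OF v(3) g2_bracket'(1)[OF V']])
    then show ?thesis by (simp add: br_simps)
  qed
  ultimately show ?thesis using that by blast
qed

end

section \<open>The second term of the ascending series contains a complex line\<close>

context snn_eight begin

lemma closed_form_on_g2:
  assumes "\<And>X Y. X \<in> g 2 \<Longrightarrow> Y \<in> g 2 \<Longrightarrow> V \<noteq> X + J Y"
  obtains \<omega> v where "\<omega> \<in> forms10 J" "\<omega> v \<noteq> 0" "\<And>X. X \<in> g 2 \<Longrightarrow> \<omega> X = 0" "\<And>X Y. \<omega> (br X Y) = 0"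
proof -
  have "V \<notin> {x + J y |x y. x \<in> g 2 \<and> y \<in> g 2}" using assms by auto
  then have "{x + J y |x y. x \<in> g 2 \<and> y \<in> g 2} \<noteq> UNIV" by (metis UNIV_I)
  then show ?thesis by (rule closed_form10) (blast intro: that)
qed

lemma real_plane_coordinates:
  fixes S :: "'a set"
  assumes S: "subspace S"
    and 1: "a *\<^sub>R X + b *\<^sub>R U \<in> S" and 2: "c *\<^sub>R X + d *\<^sub>R U \<in> S" and det: "a * d \<noteq> b * c"
  shows "X \<in> S" "U \<in> S"
proof -
  have det': "a * d - b * c \<noteq> 0" using det by simp
  have "(1 / (a * d - b * c)) *\<^sub>R (d *\<^sub>R (a *\<^sub>R X + b *\<^sub>R U) - b *\<^sub>R (c *\<^sub>R X + d *\<^sub>R U)) \<in> S"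
    using S 1 2 by (intro subspace_scale subspace_diff)
  also have "d *\<^sub>R (a *\<^sub>R X + b *\<^sub>R U) - b *\<^sub>R (c *\<^sub>R X + d *\<^sub>R U) = (a * d - b * c) *\<^sub>R X"
    by (simp add: algebra_simps)
  finally show "X \<in> S" using det' by simp
  have "(1 / (a * d - b * c)) *\<^sub>R (a *\<^sub>R (c *\<^sub>R X + d *\<^sub>R U) - c *\<^sub>R (a *\<^sub>R X + b *\<^sub>R U)) \<in> S"
    using S 1 2 by (intro subspace_scale subspace_diff)
  also have "a *\<^sub>R (c *\<^sub>R X + d *\<^sub>R U) - c *\<^sub>R (a *\<^sub>R X + b *\<^sub>R U) = (a * d - b * c) *\<^sub>R U"
    by (simp add: algebra_simps)
  finally show "U \<in> S" using det' by simp
qed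

text \<open>Assume that \<open>g 2\<close>, with basis \<open>X\<close>, \<open>U\<close>, \<open>Z\<close>, contains no complex line. Then \<open>ker T\<close> is the
  complexification of \<open>g 2\<close>, and a closed (1,0)-form shows that it contains all brackets. Applying \<open>T\<close>
  to a bracket then gives \<open>[T Y, Y'] = - [Y, T Y']\<close>: the image of \<open>T\<close>, a complex line, commutes with
  \<open>ker T\<close>, and \<open>[T Y, Y']\<close> is symmetric. Put \<open>E = T V\<close>, \<open>P = [E, V]\<close>, \<open>Q = [E, J V] = [J E, V]\<close> and
  \<open>R = [J E, J V]\<close>, so that \<open>R = P + 2 J Q\<close> by integrability. If the line meets \<open>g 2\<close>, nilpotency of
  \<open>ad (J V)\<close> gives \<open>Q = 0\<close> and \<open>E\<close>, \<open>J E\<close> both lie in \<open>g 2\<close>. Otherwise a dimension count gives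
  \<open>ker T = image T + g 2 + \<real> J Z\<close>, and \<open>E\<close> can be chosen with \<open>P\<close>, \<open>Q \<in> g 2\<close>; then \<open>J Q \<in> g 2\<close> as well,
  so \<open>Q = 0\<close>, \<open>P\<close> is central, and \<open>E\<close> falls into \<open>g 2\<close> after all.\<close>

lemma g2_meets_J_g2: "\<exists>X\<in>g 2. J X \<in> g 2 \<and> X \<noteq> 0"
proof (rule ccontr)
  assume "\<not> (\<exists>X\<in>g 2. J X \<in> g 2 \<and> X \<noteq> 0)"
  then have real: "W = 0" if "W \<in> g 2" "J W \<in> g 2" for W using that by metis
  have Zg2: "Z \<in> g 2" using g1_le_g2[OF scaleR_Z_in_g1[of 1]] by simp
  obtain X where X: "X \<in> g 2" "\<And>a b. X \<noteq> a *\<^sub>R 0 + b *\<^sub>R Z" by (rule exists_in_g2_outside_span[of 0]) blast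
  obtain U where U: "U \<in> g 2" "\<And>a b. U \<noteq> a *\<^sub>R X + b *\<^sub>R Z" by (rule exists_in_g2_outside_span[of X]) blast
  have indep: "a = 0 \<and> b = 0 \<and> c = 0" if eq: "a *\<^sub>R X + b *\<^sub>R U + c *\<^sub>R Z = 0" for a b c
  proof -
    have "b = 0"
    proof (rule ccontr)
      assume b: "b \<noteq> 0"
      have "U = (1 / b) *\<^sub>R ((a *\<^sub>R X + b *\<^sub>R U + c *\<^sub>R Z) - a *\<^sub>R X - c *\<^sub>R Z)" using b by simp
      then have "U = (- a / b) *\<^sub>R X + (- c / b) *\<^sub>R Z" unfolding eq by (simp add: algebra_simps)
      then show False using U(2) by blast
    qed
    moreover have "a = 0"
    proof (rule ccontr)
      assume a: "a \<noteq> 0"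
      have "X = (1 / a) *\<^sub>R ((a *\<^sub>R X + b *\<^sub>R U + c *\<^sub>R Z) - c *\<^sub>R Z)" using a \<open>b = 0\<close> by simp
      then have "X = 0 *\<^sub>R 0 + (- c / a) *\<^sub>R Z" unfolding eq by (simp add: algebra_simps)
      then show False using X(2) by blast
    qed
    ultimately show ?thesis using eq Z by simp
  qed
  note span = g2_basis[OF X(1) U(1) indep]
  have T0 [simp]: "T X = 0" "T U = 0" using X U T_g2 by auto
  have cindep: "a = 0 \<and> b = 0 \<and> c = 0 \<and> d = 0"
    if V: "T V \<noteq> 0" and eq: "a \<odot> V + b \<odot> X + c \<odot> U + d \<odot> Z = 0" for V a b c d
  proof -
    have "T (a \<odot> V + b \<odot> X + c \<odot> U + d \<odot> Z) = 0" using eq by (simp add: br_simps)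
    then have "a \<odot> T V = 0" by (simp add: br_simps T_act)
    then have a: "a = 0" using V by (simp add: act_eq_0_iff)
    let ?r = "Re b *\<^sub>R X + Re c *\<^sub>R U + Re d *\<^sub>R Z" and ?i = "Im b *\<^sub>R X + Im c *\<^sub>R U + Im d *\<^sub>R Z"
    have "?r - J ?i = 0" using eq a by (simp add: act_def J_simps algebra_simps)
    then have "J ?i = ?r" by simp
    moreover have "?r \<in> g 2" "?i \<in> g 2" using X(1) U(1) Zg2 by (auto intro!: g_closed)
    ultimately have i: "?i = 0" using real by metis
    then have "?r = 0" using \<open>J ?i = ?r\<close> by (simp add: J_simps)
    then show ?thesis using indep i a by (auto simp: complex_eq_iff)
  qed
  note coords = complex_basis[OF cindep]
  have T_ker: "\<exists>W W'. Y = W + J W' \<and> W \<in> g 2 \<and> W' \<in> g 2" if "T Y = 0" for Y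
  proof -
    obtain V where V: "T V \<noteq> 0" by (rule T_nontrivial)
    obtain a b c d where Y: "Y = a \<odot> V + b \<odot> X + c \<odot> U + d \<odot> Z" using coords[OF V] .
    have "a \<odot> T V = 0" using that by (simp add: Y br_simps T_act)
    then have a: "a = 0" using V by (simp add: act_eq_0_iff)
    let ?r = "Re b *\<^sub>R X + Re c *\<^sub>R U + Re d *\<^sub>R Z" and ?i = "- (Im b *\<^sub>R X + Im c *\<^sub>R U + Im d *\<^sub>R Z)"
    have "Y = ?r + J ?i" by (simp add: Y a act_def J_simps algebra_simps)
    moreover have "?r \<in> g 2" "?i \<in> g 2" using X(1) U(1) Zg2 by (auto intro!: g_closed)
    ultimately show ?thesis by blast
  qed
  have T_rank: "\<exists>c W W'. Y = c \<odot> V + (W + J W') \<and> W \<in> g 2 \<and> W' \<in> g 2" if V: "T V \<noteq> 0" for V Y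
  proof -
    obtain a b c d where Y: "Y = a \<odot> V + b \<odot> X + c \<odot> U + d \<odot> Z" using coords[OF V] .
    have "T (b \<odot> X + c \<odot> U + d \<odot> Z) = 0" by (simp add: br_simps T_act)
    then show ?thesis using T_ker Y by (metis add.assoc)
  qed
  have T_derived: "T (br Y Y') = 0" for Y Y'
  proof -
    obtain V where V: "T V \<noteq> 0" by (rule T_nontrivial)
    have "V \<noteq> W + J W'" if "W \<in> g 2" "W' \<in> g 2" for W W'
      using V T_g2[OF that(1)] T_g2[OF that(2)] by (auto simp: br_simps T_J J_simps)
    then obtain \<omega> v where w: "\<omega> \<in> forms10 J" "\<omega> v \<noteq> 0" "\<And>X. X \<in> g 2 \<Longrightarrow> \<omega> X = 0" "\<And>X Y. \<omega> (br X Y) = 0"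
      by (rule closed_form_on_g2[of V]) blast+
    note [simp] = linear_add[OF forms10_D(1)[OF w(1)]] forms10_D(2,3)[OF w(1)]
    have wV: "\<omega> V \<noteq> 0" using T_rank[OF V, of v] w(2,3) by auto
    obtain c W W' where Y: "br Y Y' = c \<odot> V + (W + J W')" "W \<in> g 2" "W' \<in> g 2"
      using T_rank[OF V] by metis
    have "\<omega> (br Y Y') = c * \<omega> V" using Y(2,3) w(3) by (simp add: Y(1))
    then have "c = 0" using w(4)[of Y Y'] wV by simp
    then show ?thesis using Y T_g2 by (simp add: br_simps T_J J_simps)
  qed
  have T_sym: "br (T Y) Y' = - br Y (T Y')" for Y Y'
    using T_derived[of Y Y'] br_derivation[of "J Z" Y Y'] by (simp add: eq_neg_iff_add_eq_0)
  have T_comm: "br (T Y) Y' = 0" if "T Y' = 0" for Y Y'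
    using that T_sym by (simp add: br_simps)
  have T_sym': "br (T Y) Y' = br (T Y') Y" for Y Y'
    using T_sym[of Y Y'] br_anti[of Y "T Y'"] by simp
  have central_criterion: "br W Y \<in> S"
    if S: "subspace S" and V: "T V \<noteq> 0" and 1: "br W V \<in> S" "br W (J V) \<in> S"
      and 2: "\<And>Y. T Y = 0 \<Longrightarrow> br W Y = 0" for S W V Y
  proof -
    obtain c W1 W2 where Y: "Y = c \<odot> V + (W1 + J W2)" "W1 \<in> g 2" "W2 \<in> g 2"
      using T_rank[OF V] by metis
    have "T (W1 + J W2) = 0" using Y T_g2 by (simp add: br_simps T_J J_simps)
    then have "br W (W1 + J W2) = 0" by (rule 2)
    then have "br W Y = br W (c \<odot> V)" unfolding Y(1) bilinear_radd[OF bil, of W "c \<odot> V"] by simp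
    also have "\<dots> = Re c *\<^sub>R br W V - Im c *\<^sub>R br W (J V)" by (simp add: br_simps act_def)
    finally have "br W Y = Re c *\<^sub>R br W V - Im c *\<^sub>R br W (J V)" .
    then show ?thesis using S 1 by (simp add: subspace_diff subspace_scale)
  qed
  have in_g1: "W \<in> g 1" if "T V \<noteq> 0" "br W V = 0" "br W (J V) = 0" "\<And>Y. T Y = 0 \<Longrightarrow> br W Y = 0" for W V
    using central_criterion[of "{0}", OF _ that(1)] that(2-) unfolding g1_iff by (auto simp: subspace_def)
  have in_g2: "W \<in> g 2" if "T V \<noteq> 0" "br W V \<in> g 1" "br W (J V) \<in> g 1" "\<And>Y. T Y = 0 \<Longrightarrow> br W Y = 0" for W V
    using central_criterion[OF g_subspace[of 1] that(1)] that(2-) unfolding g2_iff by auto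
  \<comment> \<open>Integrability for \<open>T V\<close> and \<open>V\<close>, with \<open>[J T V, V] = [T V, J V]\<close> by symmetry.\<close>
  have nij: "br (J (T V)) (J V) = br (T V) V + 2 *\<^sub>R J (br (T V) (J V))" for V
    using nijenhuis[of "T V" V] T_sym'[of "J V" V] by (simp add: T_J algebra_simps scaleR_2)
  have nonzero: "T V = 0" if TV: "T V \<in> g 2" for V
  proof (rule ccontr)
    assume V: "T V \<noteq> 0"
    obtain p where p: "br (T V) V = p *\<^sub>R Z" using g2E[OF TV] .
    obtain q where q: "br (T V) (J V) = q *\<^sub>R Z" using g2E[OF TV] .
    have JE1: "br (J (T V)) V = q *\<^sub>R Z" using q T_sym'[of "J V" V] by (simp add: T_J)
    have JE2: "br (J (T V)) (J V) = p *\<^sub>R Z + (2 * q) *\<^sub>R J Z"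
      using nij[of V] p q by (simp add: J_simps)
    have "q = 0"
    proof (rule ccontr)
      assume q0: "q \<noteq> 0"
      \<comment> \<open>Modulo \<open>\<real> Z\<close>, \<open>ad (J V)\<close> would map \<open>J Z\<close> to \<open>- J T V\<close> and this to \<open>- 2 q J Z\<close>, against nilpotency.\<close>
      let ?B = "{J Z, J (T V)}"
      let ?C = "span ({br Y b |Y b. b \<in> ?B} \<union> g 1)"
      have "br (- J V) (J Z) \<in> ?C" by (intro span_base) blast
      then have 1: "J (T V) \<in> ?C" by (simp add: br_simps br_JZ T_J)
      have "br (- J V) (J (T V)) \<in> ?C" by (intro span_base) blast
      then have m1: "p *\<^sub>R Z + (2 * q) *\<^sub>R J Z \<in> ?C"
        using JE2 br_anti[of "J (T V)" "J V"] by (simp add: br_simps)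
      have m2: "p *\<^sub>R Z \<in> ?C" using scaleR_Z_in_g1 by (intro span_base) blast
      have "(1 / (2 * q)) *\<^sub>R ((p *\<^sub>R Z + (2 * q) *\<^sub>R J Z) - p *\<^sub>R Z) \<in> ?C"
        by (rule span_scale[OF span_diff[OF m1 m2]])
      then have "J Z \<in> ?C" using q0 by simp
      with 1 have "?B \<subseteq> ?C" by simp
      moreover have "br Y W \<in> g 1" if "W \<in> g 1" for W Y
        using g2_bracket(2)[OF g1_le_g2[OF that]] .
      ultimately have "?B \<subseteq> g 1" by (intro engel_dual[OF g_subspace])
      then have "1 *\<^sub>R J Z \<in> g 1" by simp
      then show False using JZ_notin_g1 zero_neq_one by metis
    qed
    then have "J (T V) \<in> g 2" using JE1 JE2 T_comm[of _ "J V"] scaleR_Z_in_g1 scaleR_Z_in_g1[of 0]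
      by (intro in_g2[OF V]) (auto simp: T_J[symmetric] T_comm)
    then show False using real TV V by blast
  qed
  obtain V0 where V0: "T V0 \<noteq> 0" by (rule T_nontrivial)
  define S where "S = {W. \<exists>V t. W - T V - t *\<^sub>R J Z \<in> g 2}"
  have S: "subspace S"
    unfolding subspace_def
  proof (intro conjI ballI allI)
    show "0 \<in> S" unfolding S_def mem_Collect_eq
      by (rule exI[of _ 0], rule exI[of _ 0]) (simp add: br_simps g_closed(1))
    fix W W' assume "W \<in> S" "W' \<in> S"
    then obtain V t V' t' where *: "W - T V - t *\<^sub>R J Z \<in> g 2" "W' - T V' - t' *\<^sub>R J Z \<in> g 2"
      unfolding S_def by blast
    have "(W + W') - T (V + V') - (t + t') *\<^sub>R J Z = (W - T V - t *\<^sub>R J Z) + (W' - T V' - t' *\<^sub>R J Z)"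
      by (simp add: br_simps algebra_simps)
    then show "W + W' \<in> S" using g_closed(2)[OF *] unfolding S_def by (metis (mono_tags, lifting) mem_Collect_eq)
  next
    fix r W assume "W \<in> S"
    then obtain V t where *: "W - T V - t *\<^sub>R J Z \<in> g 2" unfolding S_def by blast
    have "r *\<^sub>R W - T (r *\<^sub>R V) - (r * t) *\<^sub>R J Z = r *\<^sub>R (W - T V - t *\<^sub>R J Z)"
      by (simp add: br_simps algebra_simps)
    then show "r *\<^sub>R W \<in> S" using g_closed(4)[OF *, of r] unfolding S_def by (metis (mono_tags, lifting) mem_Collect_eq)
  qed
  have g2S: "W \<in> S" if "W \<in> g 2" for W unfolding S_def mem_Collect_eq
    by (rule exI[of _ 0], rule exI[of _ 0]) (simp add: br_simps that)
  have TS: "T W \<in> S" for W unfolding S_def mem_Collect_eq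
    by (rule exI[of _ W], rule exI[of _ 0]) (simp add: g_closed(1))
  have JZS: "J Z \<in> S" unfolding S_def mem_Collect_eq
    by (rule exI[of _ 0], rule exI[of _ 1]) (simp add: br_simps g_closed(1))
  \<comment> \<open>Modulo \<open>g 2 + \<real> J Z\<close>, the vectors \<open>T V0\<close> and \<open>T (J V0)\<close> are real combinations of \<open>J X\<close> and \<open>J U\<close>.
    These are independent: a dependence would give a nonzero \<open>T W\<close> in \<open>g 2 + \<real> J Z\<close>, hence in \<open>g 2\<close>.\<close>
  have JXU: "J X \<in> S" "J U \<in> S"
  proof -
    have "T (T V0) = 0" by (rule T_derived)
    moreover obtain e a b c where E: "T V0 = e \<odot> V0 + a \<odot> X + b \<odot> U + c \<odot> Z" using coords[OF V0] .
    ultimately have "e \<odot> T V0 = 0" by (simp add: br_simps T_act)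
    then have e: "e = 0" using V0 by (simp add: act_eq_0_iff)
    define x y where "x = T V0 - Re a *\<^sub>R X - Re b *\<^sub>R U - Re c *\<^sub>R Z + Im c *\<^sub>R J Z"
      and "y = T (J V0) - Im a *\<^sub>R X - Im b *\<^sub>R U - Im c *\<^sub>R Z - Re c *\<^sub>R J Z"
    have x: "x = (- Im a) *\<^sub>R J X + (- Im b) *\<^sub>R J U" and y: "y = Re a *\<^sub>R J X + Re b *\<^sub>R J U"
      unfolding x_def y_def T_J E e by (simp_all add: act_def J_simps algebra_simps)
    have xS: "x \<in> S" and yS: "y \<in> S" unfolding x_def y_def using TS JZS g2S X(1) U(1) Zg2
      by (auto intro!: subspace_diff[OF S] subspace_add[OF S] subspace_scale[OF S])
    have det: "(- Im a) * Re b \<noteq> (- Im b) * Re a"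
    proof
      assume det: "(- Im a) * Re b = (- Im b) * Re a"
      have key: "p = 0 \<and> q = 0" if pq: "p *\<^sub>R x + q *\<^sub>R y = 0" for p q
      proof -
        have *: "T (p *\<^sub>R V0 + q *\<^sub>R J V0) - (q * Re c - p * Im c) *\<^sub>R J Z
          = p *\<^sub>R x + q *\<^sub>R y + (p * Re a + q * Im a) *\<^sub>R X + (p * Re b + q * Im b) *\<^sub>R U + (p * Re c + q * Im c) *\<^sub>R Z"
          unfolding x_def y_def by (simp add: br_simps algebra_simps)
        have "T (p *\<^sub>R V0 + q *\<^sub>R J V0) - (q * Re c - p * Im c) *\<^sub>R J Z \<in> g 2"
          unfolding * pq using X(1) U(1) Zg2 by (simp add: g_closed)
        then have "T (p *\<^sub>R V0 + q *\<^sub>R J V0) \<in> g 2" using T_JZ_g2 by fastforce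
        then have "T (p *\<^sub>R V0 + q *\<^sub>R J V0) = 0" by (rule nonzero)
        moreover have "p *\<^sub>R V0 + q *\<^sub>R J V0 = Complex p (- q) \<odot> V0" by (simp add: act_def)
        ultimately have "Complex p (- q) \<odot> T V0 = 0" by (simp only: T_act)
        then show ?thesis using V0 by (simp add: act_eq_0_iff complex_eq_iff)
      qed
      \<comment> \<open>The rows of coefficients being proportional, each of them provides a dependence.\<close>
      have "Re a *\<^sub>R x + Im a *\<^sub>R y = 0" "Re b *\<^sub>R x + Im b *\<^sub>R y = 0"
        using det unfolding x y by (simp_all add: algebra_simps flip: scaleR_left_distrib)
      then have "Re a = 0" "Im a = 0" "Re b = 0" "Im b = 0" using key by blast+
      then have "1 *\<^sub>R x + 0 *\<^sub>R y = 0" unfolding x by simp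
      then show False using key by fastforce
    qed
    show "J X \<in> S" "J U \<in> S"
      using real_plane_coordinates[OF S] xS yS det unfolding x y by metis+
  qed
  have ker_S: "\<exists>V t. Y - T V - t *\<^sub>R J Z \<in> g 2" if TY: "T Y = 0" for Y
  proof -
    obtain W W' where Y: "Y = W + J W'" "W \<in> g 2" "W' \<in> g 2" using T_ker[OF TY] by blast
    obtain a b c where "W' = a *\<^sub>R X + b *\<^sub>R U + c *\<^sub>R Z" using span[OF _ Y(3)] by metis
    then have "J W' = a *\<^sub>R J X + b *\<^sub>R J U + c *\<^sub>R J Z" by (simp add: J_simps)
    then have "Y \<in> S" unfolding Y(1) using g2S[OF Y(2)] JXU JZS
      by (auto intro!: subspace_add[OF S] subspace_scale[OF S])
    then show ?thesis unfolding S_def by blast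
  qed
  then have D: "\<And>X Y. \<exists>V t. br X Y - T V - t *\<^sub>R J Z \<in> g 2" using T_derived by blast
  obtain V where V: "T V \<notin> g 2" "\<And>Y. br (T V) Y \<in> g 2"
    by (rule exists_image_T_in_g3[OF D, of V0]) (use nonzero V0 in blast)+
  have V': "T V \<noteq> 0" using V(1) g_closed(1) by metis
  define P Q R where "P = br (T V) V" and "Q = br (T V) (J V)" and "R = br (J (T V)) (J V)"
  have JEV: "br (J (T V)) V = Q" unfolding Q_def using T_sym'[of "J V" V] by (simp add: T_J)
  have R: "R = P + 2 *\<^sub>R J Q" unfolding P_def Q_def R_def by (rule nij)
  have PQ: "P \<in> g 2" "Q \<in> g 2" unfolding P_def Q_def using V(2) by auto
  have comm: "br (br (T W) Y) Y' = 0" if "T Y' = 0" for W Y Y'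
    using br_derivation[of "T W" Y Y'] T_comm[OF that] T_comm[OF T_derived] by (simp add: br_simps)
  have commP: "br P Y = 0" "br Q Y = 0" "br R Y = 0" if "T Y = 0" for Y
    using comm[OF that] unfolding P_def Q_def R_def T_J[symmetric] by auto
  \<comment> \<open>The operators \<open>ad V\<close> and \<open>ad (J V)\<close> commute on the image of \<open>T\<close>, because that image commutes with
    \<open>[V, J V]\<close>, an element of \<open>ker T\<close>.\<close>
  have swap: "br (br (T W) V) (J V) = br (br (T W) (J V)) V" for W
  proof -
    have "br (T W) (br V (J V)) = 0" by (rule T_comm[OF T_derived])
    then have "br (br (T W) V) (J V) + br V (br (T W) (J V)) = 0"
      using br_derivation[of "T W" V "J V"] by simp
    then show ?thesis using br_anti[of V "br (T W) (J V)"] by simp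
  qed
  have 1: "br P (J V) = br Q V" using swap[of V] unfolding P_def Q_def .
  have 2: "br Q (J V) = br R V" using swap[of "J V"] JEV unfolding R_def T_J by simp
  have JQ: "J Q = (1/2) *\<^sub>R (R - P)" using R by simp
  have JQV: "br (J Q) V = (1/2) *\<^sub>R (br Q (J V) - br P V)" unfolding JQ 2 by (simp add: br_simps)
  have JQV1: "br (J Q) V \<in> g 1" unfolding JQV using g2_bracket(1)[OF PQ(1)] g2_bracket(1)[OF PQ(2)]
    by (intro g_closed)
  obtain t where t: "br (J Q) V + br Q (J V) = t *\<^sub>R Z"
    using g1E g_closed(2)[OF JQV1 g2_bracket(1)[OF PQ(2)]] by metis
  \<comment> \<open>Integrability for \<open>Q\<close> and \<open>V\<close>. The term with \<open>J Z\<close> is excluded next: twice the left-hand side is a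
    bracket of \<open>R - P\<close>, so it lies in the ideal \<open>image T + g 2\<close>, which contains no nonzero multiple of \<open>J Z\<close>.\<close>
  have JQJV: "br (J Q) (J V) = br Q V + t *\<^sub>R J Z"
    using nijenhuis[of Q V] t by (metis (no_types, lifting) J_simps(1,4) add.assoc eq_iff_diff_eq_0)
  have "t = 0"
  proof -
    obtain W where W: "br (J V) (T (J V)) - T W \<in> g 2" using bracket_image_T[OF D, of "J V" "J V"] by metis
    define G where "G = br (J V) (T (J V)) - T W"
    have RJV: "R = - G - T W" unfolding R_def G_def T_J using br_anti[of "J V" "J (T V)"] by simp
    obtain W' where W': "br (J V) (T W) - T W' \<in> g 2" using bracket_image_T[OF D, of "J V" W] by metis
    define H where "H = br (J V) (T W) - T W'"
    have "2 *\<^sub>R br (J Q) (J V) = br R (J V) - br P (J V)" unfolding JQ by (simp add: br_simps)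
    also have "\<dots> = - br G (J V) + br (J V) (T W) - br P (J V)" unfolding RJV using br_anti[of "J V" "T W"]
      by (simp add: br_simps)
    finally have "T W' - (2 * t) *\<^sub>R J Z = 2 *\<^sub>R br Q V + br G (J V) + br P (J V) - H"
      unfolding JQJV H_def by (simp add: algebra_simps)
    also have "\<dots> \<in> g 2"
      using W' W g2_bracket' PQ unfolding G_def[symmetric] H_def[symmetric] by (intro g_closed) auto
    finally show "t = 0" using T_JZ_g2 by fastforce
  qed
  have "J Q \<in> g 2"
  proof (rule in_g2[OF V' JQV1])
    show "br (J Q) (J V) \<in> g 1" using JQJV \<open>t = 0\<close> g2_bracket(1)[OF PQ(2)] by simp
    show "br (J Q) Y = 0" if "T Y = 0" for Y unfolding JQ using commP[OF that] by (simp add: br_simps)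
  qed
  then have Q0: "Q = 0" using real PQ by blast
  then have RP: "R = P" using R by (simp add: J_simps)
  have "P \<in> g 1"
  proof (rule in_g1[OF V'])
    show "br P (J V) = 0" "br P V = 0" using 1 2 Q0 RP by (simp_all add: br_simps)
  qed (rule commP)
  have "T V \<in> g 2"
  proof (rule in_g2[OF V'])
    show "br (T V) V \<in> g 1" using \<open>P \<in> g 1\<close> unfolding P_def .
    show "br (T V) (J V) \<in> g 1" using Q0 g_closed(1)[of 1] unfolding Q_def by (simp only:)
  qed (rule T_comm)
  then show False using V(1) by blast
qed

end

section \<open>Adapted bases\<close>

context snn_eight begin

context
  fixes X
  assumes X: "X \<in> g 2" "J X \<in> g 2" "X \<noteq> 0"
begin

lemma act_X_in_g2: "c \<odot> X \<in> g 2"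
  unfolding act_def using X by (intro g_closed)

lemma Z_in_g2: "t *\<^sub>R Z \<in> g 2"
  by (rule g1_le_g2[OF scaleR_Z_in_g1])

text \<open>A complex multiple of \<open>X\<close> lies in \<open>g 2\<close>, whereas no nonzero real multiple of \<open>J Z\<close> does.\<close>

lemma XZ_indep:
  assumes "c \<odot> X + d \<odot> Z = 0"
  shows "c = 0 \<and> d = 0"
proof -
  have 1: "r = 0" if "c' \<odot> X + r *\<^sub>R Z + s *\<^sub>R J Z = 0" for c' r s
  proof -
    have "J (c' \<odot> X + r *\<^sub>R Z + s *\<^sub>R J Z) = 0" using that by simp
    then have "r *\<^sub>R J Z = s *\<^sub>R Z - (c' * (- \<i>)) \<odot> X"
      by (simp add: J_simps J_act J_as_act[of X] act_mult algebra_simps add_eq_0_iff)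
    then have "r *\<^sub>R J Z \<in> g 2" using act_X_in_g2 Z_in_g2 g_closed(3) by metis
    then show ?thesis by (rule JZ_notin_g2)
  qed
  have "Re d = 0" using 1[of c "Re d" "- Im d"] assms by (simp add: act_def algebra_simps)
  moreover have "Im d = 0"
  proof -
    have "(- \<i>) \<odot> (c \<odot> X + d \<odot> Z) = 0" using assms by simp
    then have "(- \<i> * c) \<odot> X + Im d *\<^sub>R Z + (- Re d) *\<^sub>R (- J Z) = 0"
      by (simp add: act_def J_simps algebra_simps)
    then show ?thesis using 1[of "- \<i> * c" "Im d" "Re d"] by simp
  qed
  ultimately have "d = 0" by (simp add: complex_eq_iff)
  then show ?thesis using assms X(3) by (simp add: act_eq_0_iff)
qed

lemma g2_decompose: assumes "W \<in> g 2" obtains c t where "W = c \<odot> X + t *\<^sub>R Z"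
proof -
  have "a = 0 \<and> b = 0 \<and> c = 0" if "a *\<^sub>R X + b *\<^sub>R J X + c *\<^sub>R Z = 0" for a b c
  proof -
    have "Complex a (- b) \<odot> X + of_real c \<odot> Z = 0" using that by (simp add: act_def)
    then have "Complex a (- b) = 0 \<and> complex_of_real c = 0" by (rule XZ_indep)
    then show ?thesis by (auto simp: complex_eq_iff)
  qed
  then obtain a b c where "W = a *\<^sub>R X + b *\<^sub>R J X + c *\<^sub>R Z"
    using g2_basis[OF X(1,2) _ assms] by metis
  then have "W = Complex a (- b) \<odot> X + c *\<^sub>R Z" by (simp add: act_def)
  then show ?thesis by (rule that)
qed

definition M where "M = {c \<odot> X + d \<odot> Z |c d. True}"

lemma MI: "c \<odot> X + d \<odot> Z \<in> M" unfolding M_def by blast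

lemma g2_le_M: "W \<in> g 2 \<Longrightarrow> W \<in> M"
  using g2_decompose MI act_of_real by metis

lemma M_act: "W \<in> M \<Longrightarrow> c \<odot> W \<in> M"
proof -
  assume "W \<in> M"
  then obtain a b where "W = a \<odot> X + b \<odot> Z" unfolding M_def by blast
  then have "c \<odot> W = (c * a) \<odot> X + (c * b) \<odot> Z" by (simp add: act_add_right act_mult)
  then show ?thesis using MI by simp
qed

lemma M_add: "W \<in> M \<Longrightarrow> W' \<in> M \<Longrightarrow> W + W' \<in> M"
proof -
  assume "W \<in> M" "W' \<in> M"
  then obtain a b a' b' where "W = a \<odot> X + b \<odot> Z" "W' = a' \<odot> X + b' \<odot> Z" unfolding M_def by blast
  then have "W + W' = (a + a') \<odot> X + (b + b') \<odot> Z" by (simp add: act_add_left)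
  then show ?thesis using MI by simp
qed

lemma M_subspace: "subspace M"
  using M_add M_act[of _ "of_real c" for c] MI[of 0 0]
  by (simp add: subspace_def act_of_real)

lemma M_J: "W \<in> M \<Longrightarrow> J W \<in> M"
  using M_act[of W "- \<i>"] by (simp add: act_minus_left act_i)

lemmas M_closed = subspace_0[OF M_subspace] M_add subspace_diff[OF M_subspace]
  subspace_scale[OF M_subspace] subspace_neg[OF M_subspace] M_J M_act

lemma T_vanishes_on_M: "W \<in> M \<Longrightarrow> T W = 0"
  unfolding M_def using T_g2[OF X(1)] by (auto simp: br_simps T_act)

lemma M_mod_JZ: assumes "W \<in> M" obtains t where "W - t *\<^sub>R J Z \<in> g 2"
proof -
  obtain c d where W: "W = c \<odot> X + d \<odot> Z" using assms unfolding M_def by blast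
  have "W - (- Im d) *\<^sub>R J Z = c \<odot> X + Re d *\<^sub>R Z" unfolding W by (simp add: act_def)
  also have "\<dots> \<in> g 2" by (rule g_closed(2)[OF act_X_in_g2 Z_in_g2])
  finally show ?thesis by (rule that)
qed

text \<open>The \<open>Z\<close>-component of \<open>T V\<close> vanishes: its imaginary part by \<open>T_JZ_g2\<close> for \<open>V\<close>, its real part by
  the same lemma for \<open>J V\<close>.\<close>

lemma image_T_in_M: assumes "T V \<in> M" obtains c where "T V = c \<odot> X"
proof -
  obtain c d where W: "T V = c \<odot> X + d \<odot> Z" using assms unfolding M_def by blast
  have "T V - (- Im d) *\<^sub>R J Z = c \<odot> X + Re d *\<^sub>R Z" unfolding W by (simp add: act_def)
  also have "\<dots> \<in> g 2" by (rule g_closed(2)[OF act_X_in_g2 Z_in_g2])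
  finally have i: "Im d = 0" using T_JZ_g2 by fastforce
  have "T (J V) - Re d *\<^sub>R J Z = c \<odot> J X" unfolding T_J W by (simp add: J_simps J_act[symmetric] act_def i)
  also have "c \<odot> J X = (- \<i> * c) \<odot> X" by (simp add: J_as_act[of X] act_mult mult.commute)
  also have "\<dots> \<in> g 2" by (rule act_X_in_g2)
  finally have "Re d = 0" by (rule T_JZ_g2)
  then have "T V = c \<odot> X" using W i by (simp add: act_def)
  then show ?thesis by (rule that)
qed

lemma complex_basis_mod_M:
  assumes "\<And>a b. a \<odot> V1 + b \<odot> V2 \<in> M \<Longrightarrow> a = 0 \<and> b = 0"
    and eq: "a \<odot> V1 + b \<odot> V2 + c \<odot> X + d \<odot> Z = 0"
  shows "a = 0 \<and> b = 0 \<and> c = 0 \<and> d = 0"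
proof -
  have "a \<odot> V1 + b \<odot> V2 = - (c \<odot> X + d \<odot> Z)" using eq by (simp add: add.assoc add_eq_0_iff2)
  then have "a = 0 \<and> b = 0" using assms(1) M_closed(5)[OF MI] by metis
  then show ?thesis using eq XZ_indep[of c d] by auto
qed

text \<open>The bracket relations of the complex basis \<open>V1\<close>, \<open>V2\<close>, \<open>X\<close>, \<open>Z\<close> behind the structure equations. Each
  conjunct after the first, which is linear independence, excludes a group of coefficients, namely
  \<open>V2\<close> bracketing into \<open>g 2\<close> those of \<open>d \<omega>2\<close> and of \<open>Im d \<omega>4\<close> that involve \<open>\<omega>2\<close>, the shape of \<open>T V1\<close> and of \<open>[V1, J V1]\<close> those of \<open>d \<omega>1\<close> and the
  occurrence of \<open>\<omega>4\<close> in \<open>d \<omega>4\<close>, and \<open>[X, J X] = 0\<close> the term \<open>\<omega>3 \<and> cbar \<omega>3\<close> in \<open>d \<omega>4\<close>.\<close>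

definition adapted where
  "adapted V1 V2 \<longleftrightarrow>
     (\<forall>a b c d. a \<odot> V1 + b \<odot> V2 + c \<odot> X + d \<odot> Z = 0 \<longrightarrow> a = 0 \<and> b = 0 \<and> c = 0 \<and> d = 0) \<and>
     (\<forall>Y. br V2 Y \<in> g 2 \<and> br (J V2) Y \<in> g 2) \<and>
     (\<exists>b c. T V1 = b \<odot> V2 + c \<odot> X) \<and>
     (\<exists>b c d. br V1 (J V1) = b \<odot> V2 + c \<odot> X + d \<odot> Z) \<and>
     br X (J X) = 0"

lemma br_X_g1: "br (c \<odot> X) Y \<in> g 1" "br Y (c \<odot> X) \<in> g 1"
  using g2_bracket act_X_in_g2 by blast+

text \<open>Here \<open>T Y\<close> is always a complex multiple of \<open>X\<close>, so \<open>T\<close> amounts to a (1,0)-form. It is closed, because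
  \<open>T\<close> of a bracket is a real multiple of \<open>Z\<close> as well as a complex multiple of \<open>X\<close>. With
  \<open>T V1 = X\<close>, the kernel of \<open>T\<close> is a complex complement of \<open>V1\<close> containing \<open>M\<close>; let \<open>V2\<close> complete \<open>M\<close> to this kernel. The kernel brackets into \<open>M\<close> by Engel's
  argument for \<open>V2\<close> and integrability for \<open>J V2\<close>. As \<open>M\<close> commutes with the kernel, brackets
  inside the kernel are central, and the Jacobi identity for \<open>W\<close>, \<open>V1\<close>, \<open>J V1\<close>, with \<open>W\<close> in the kernel,
  removes the \<open>J Z\<close>-components of \<open>[W, V1]\<close> and \<open>[W, J V1]\<close>.\<close>

lemma adapted_T_into_M:
  assumes TM: "\<And>V. T V \<in> M"
  obtains V1 V2 where "adapted V1 V2"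
proof -
  obtain V where V: "T V \<noteq> 0" by (rule T_nontrivial)
  obtain c where c: "T V = c \<odot> X" using image_T_in_M[OF TM] .
  define V1 where "V1 = (1 / c) \<odot> V"
  have TV1: "T V1 = X" using V c unfolding V1_def by (auto simp: T_act act_mult)
  have br_T: "br (T Y) Y' \<in> g 1" for Y Y'
    using image_T_in_M[OF TM[of Y]] br_X_g1(1) by metis
  have T_g1: "T Y = 0" if TY: "T Y \<in> g 1" for Y
  proof -
    obtain t where t: "T Y = t *\<^sub>R Z" using g1E[OF TY] .
    obtain e where e: "T Y = e \<odot> X" using image_T_in_M[OF TM] .
    have "e \<odot> X + (- of_real t) \<odot> Z = 0" using t e by (simp add: act_minus_left act_of_real)
    then have "e = 0" using XZ_indep by blast
    then show ?thesis using e by simp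
  qed
  have T_derived: "T (br Y Y') = 0" for Y Y'
  proof (rule T_g1)
    have "br Y (T Y') \<in> g 1" using br_T[of Y' Y] br_anti[of Y "T Y'"] g_closed(5) by metis
    then show "T (br Y Y') \<in> g 1" using br_T[of Y Y'] br_derivation[of "J Z" Y Y'] g_closed(2) by metis
  qed
  have T_rank: "\<exists>a W. Y = a \<odot> V1 + W \<and> T W = 0" for Y
  proof -
    obtain e where e: "T Y = e \<odot> X" using image_T_in_M[OF TM] .
    have "T (Y - e \<odot> V1) = 0" by (simp add: br_simps T_act TV1 e)
    then show ?thesis by (intro exI[of _ e] exI[of _ "Y - e \<odot> V1"]) simp
  qed
  have M_br: "br W Y \<in> M" "br Y W \<in> M" if W: "W \<in> M" for W Y
  proof -
    obtain t where t: "W - t *\<^sub>R J Z \<in> g 2" using M_mod_JZ[OF W] .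
    have "br (W - t *\<^sub>R J Z) Y + t *\<^sub>R T Y \<in> M"
      using M_closed(2)[OF g2_le_M[OF g2_bracket'(1)[OF t]] M_closed(4)[OF TM]] .
    then show 1: "br W Y \<in> M" by (simp add: br_simps)
    show "br Y W \<in> M" using M_closed(5)[OF 1] br_anti[of Y W] by simp
  qed
  \<comment> \<open>The kernel of \<open>T\<close> is larger than \<open>M\<close>, since \<open>V1\<close>, \<open>X\<close>, \<open>Z\<close> do not span.\<close>
  obtain V0 where V0: "T V0 = 0" "V0 \<notin> M"
  proof -
    obtain U where U: "\<And>a b c. U \<noteq> a \<odot> V1 + b \<odot> X + c \<odot> Z" by (rule exists_outside_complex_span[of V1 X Z]) blast
    obtain a W where W: "U = a \<odot> V1 + W" "T W = 0" using T_rank by metis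
    have "W \<notin> M"
    proof
      assume "W \<in> M"
      then obtain b c where "W = b \<odot> X + c \<odot> Z" unfolding M_def by blast
      then show False using U W by (metis add.assoc)
    qed
    with W(2) show ?thesis by (rule that)
  qed
  have "\<exists>V2. T V2 = 0 \<and> V2 \<notin> M \<and> (\<forall>Y. br V2 Y \<in> M)"
  proof (rule engel[of "{W. T W = 0}" M])
    show "\<exists>v\<in>{W. T W = 0}. v \<notin> M" using V0 by blast
    show "br v Y \<in> {W. T W = 0}" for v Y using T_derived by blast
  qed (use M_closed(1) in auto)
  then obtain V2 where V2: "T V2 = 0" "V2 \<notin> M" "\<And>Y. br V2 Y \<in> M" by blast
  have mod_M: "a = 0 \<and> b = 0" if "a \<odot> V1 + b \<odot> V2 \<in> M" for a b
  proof -
    have "a \<odot> X = 0" using T_vanishes_on_M[OF that] by (simp add: br_simps T_act TV1 V2(1))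
    then have a: "a = 0" using X(3) by (simp add: act_eq_0_iff)
    have "b = 0"
    proof (rule ccontr)
      assume b: "b \<noteq> 0"
      have "(1 / b) \<odot> (b \<odot> V2) \<in> M" using M_act[OF that] a by simp
      then show False using V2(2) b by (simp add: act_mult)
    qed
    then show ?thesis using a by simp
  qed
  note indep = complex_basis_mod_M[OF mod_M]
  have ker: "\<exists>b c d. W = b \<odot> V2 + c \<odot> X + d \<odot> Z" if "T W = 0" for W
  proof -
    obtain a b c d where W: "W = a \<odot> V1 + b \<odot> V2 + c \<odot> X + d \<odot> Z" by (rule complex_basis[OF indep])
    have "a \<odot> X = 0" using that by (simp add: W br_simps T_act TV1 V2(1) T_g2[OF X(1)])
    then have "a = 0" using X(3) by (simp add: act_eq_0_iff)
    then show ?thesis using W by auto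
  qed
  have JV2: "br (J V2) Y \<in> M" for Y
  proof -
    \<comment> \<open>Modulo \<open>M\<close> the bracket is a complex multiple \<open>b\<close> of \<open>V2\<close>; the imaginary part of \<open>b\<close> is an eigenvalue
      of \<open>ad Y\<close> modulo \<open>M + \<real> V2\<close>.\<close>
    have real: "\<exists>r. br (J V2) Y - r *\<^sub>R V2 \<in> M" for Y
    proof -
      obtain b c d where B: "br (J V2) Y = b \<odot> V2 + c \<odot> X + d \<odot> Z" using ker[OF T_derived] by metis
      define A where "A = {r *\<^sub>R V2 + W |r W. W \<in> M}"
      have AI: "r *\<^sub>R V2 + W \<in> A" if "W \<in> M" for r W unfolding A_def using that by blast
      have A: "subspace A"
      proof -
        have "A = {x + y |x y. x \<in> span {V2} \<and> y \<in> M}" unfolding A_def span_singleton by auto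
        then show ?thesis using subspace_sums[OF subspace_span M_subspace] by simp
      qed
      have "br Y W \<in> A" if WA: "W \<in> A" for W
      proof -
        obtain r W' where W: "W = r *\<^sub>R V2 + W'" "W' \<in> M" using WA unfolding A_def by blast
        have "br Y W = 0 *\<^sub>R V2 + (br Y W' - r *\<^sub>R br V2 Y)"
          using br_anti[of Y V2] by (simp add: W(1) br_simps)
        then show ?thesis using AI[OF M_closed(3)[OF M_br(2)[OF W(2)] M_closed(4)[OF V2(3)]]] by metis
      qed
      moreover have "J V2 \<notin> A"
      proof
        assume "J V2 \<in> A"
        then obtain r W where W: "J V2 = r *\<^sub>R V2 + W" "W \<in> M" unfolding A_def by blast
        then have "0 \<odot> V1 + Complex (- r) (- 1) \<odot> V2 = W" by (simp add: act_def)
        then have "Complex (- r) (- 1) = 0" using mod_M W(2) by metis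
        then show False by (simp add: complex_eq_iff)
      qed
      moreover have "br Y (J V2) - Im b *\<^sub>R J V2 \<in> A"
      proof -
        have "br Y (J V2) - Im b *\<^sub>R J V2 = (- Re b) *\<^sub>R V2 + - (c \<odot> X + d \<odot> Z)"
          using br_anti[of Y "J V2"] by (simp add: B act_def)
        then show ?thesis using AI[OF M_closed(5)[OF MI]] by metis
      qed
      ultimately have "Im b = 0" by (intro eigenvalue_zero[OF A])
      then have "br (J V2) Y - Re b *\<^sub>R V2 = c \<odot> X + d \<odot> Z" using B by (simp add: act_def)
      then show ?thesis using MI by metis
    qed
    obtain r s where r: "br (J V2) Y - r *\<^sub>R V2 \<in> M" and s: "br (J V2) (J Y) - s *\<^sub>R V2 \<in> M"
      using real by metis
    have "br V2 Y + J (br (J V2) Y - r *\<^sub>R V2) + J (br V2 (J Y)) - (br (J V2) (J Y) - s *\<^sub>R V2)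
        = s *\<^sub>R V2 - r *\<^sub>R J V2"
      using nijenhuis[of V2 Y] by (simp add: J_simps algebra_simps)
    moreover have "br V2 Y + J (br (J V2) Y - r *\<^sub>R V2) + J (br V2 (J Y)) - (br (J V2) (J Y) - s *\<^sub>R V2) \<in> M"
      by (rule M_closed(3)[OF M_closed(2)[OF M_closed(2)[OF V2(3) M_J[OF r]] M_J[OF V2(3)]] s])
    ultimately have "s *\<^sub>R V2 - r *\<^sub>R J V2 \<in> M" by (simp only:)
    then have "0 \<odot> V1 + Complex s r \<odot> V2 \<in> M" by (simp add: act_def)
    then have "Complex s r = 0" using mod_M by blast
    then have "r = 0" by (simp add: complex_eq_iff)
    then show ?thesis using r by simp
  qed
  have ker_br: "br W Y \<in> M" if W: "T W = 0" for W Y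
  proof -
    obtain b c d where Wc: "W = b \<odot> V2 + c \<odot> X + d \<odot> Z" using ker[OF W] by blast
    have "br W Y = Re b *\<^sub>R br V2 Y - Im b *\<^sub>R br (J V2) Y + br (c \<odot> X + d \<odot> Z) Y"
      unfolding Wc act_def[of J b] by (simp add: br_simps)
    then show ?thesis using M_closed(2)[OF M_closed(3)[OF M_closed(4)[OF V2(3)] M_closed(4)[OF JV2]] M_br(1)[OF MI]]
      by metis
  qed
  have X_ker: "br (c \<odot> X) W = 0" if "T W = 0" for c W
  proof -
    have "T (br (c \<odot> V1) W) = br (c \<odot> X) W"
      using br_derivation[of "J Z" "c \<odot> V1" W] that by (simp add: T_act TV1 br_simps)
    then show ?thesis using T_derived by simp
  qed
  have M_ker: "br U W = 0" if "U \<in> M" "T W = 0" for U W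
  proof -
    obtain c d where U: "U = c \<odot> X + d \<odot> Z" using \<open>U \<in> M\<close> unfolding M_def by blast
    have "br (d \<odot> Z) W = 0" by (simp add: act_def br_simps that(2))
    then show ?thesis using X_ker[OF that(2)] by (simp add: U br_simps)
  qed
  have ker_ker: "br W W' \<in> g 1" if W: "T W = 0" "T W' = 0" for W W'
    unfolding g1_iff
  proof
    fix Y
    have "br Y (br W W') = br (br Y W) W' + br W (br Y W')" by (rule br_derivation)
    moreover have "br (br Y W) W' = 0"
      using M_ker[OF ker_br[OF W(1), of Y] W(2)] br_anti[of Y W] by (simp add: br_simps)
    moreover have "br W (br Y W') = 0"
      using M_ker[OF ker_br[OF W(2), of Y] W(1)] br_anti[of Y W'] br_anti[of W "br Y W'"] by (simp add: br_simps)
    ultimately show "br (br W W') Y = 0" using br_anti[of "br W W'" Y] by simp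
  qed
  have ker_g2: "br W Y \<in> g 2" if W: "T W = 0" for W Y
  proof -
    obtain s where s: "br W V1 - s *\<^sub>R J Z \<in> g 2" using M_mod_JZ[OF ker_br[OF W]] .
    obtain t where t: "br W (J V1) - t *\<^sub>R J Z \<in> g 2" using M_mod_JZ[OF ker_br[OF W]] .
    have 1: "br W (br V1 (J V1)) \<in> g 1" by (rule ker_ker[OF W T_derived])
    have 2: "br (br W V1 - s *\<^sub>R J Z) (J V1) \<in> g 1" by (rule g2_bracket(1)[OF s])
    have 3: "br V1 (br W (J V1) - t *\<^sub>R J Z) \<in> g 1" by (rule g2_bracket(2)[OF t])
    \<comment> \<open>The Jacobi identity for \<open>W\<close>, \<open>V1\<close>, \<open>J V1\<close>; the right-hand side is central.\<close>
    have "Complex t s \<odot> X = br (br W V1 - s *\<^sub>R J Z) (J V1) + br V1 (br W (J V1) - t *\<^sub>R J Z) - br W (br V1 (J V1))"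
      using br_derivation[of W V1 "J V1"] br_JZ[of V1] by (simp add: br_simps T_J TV1 act_def)
    then have "Complex t s \<odot> X \<in> g 1" using g_closed(3)[OF g_closed(2)[OF 2 3] 1] by metis
    then obtain r where "Complex t s \<odot> X = r *\<^sub>R Z" by (rule g1E)
    then have "Complex t s \<odot> X + (- of_real r) \<odot> Z = 0" by (simp add: act_minus_left act_of_real)
    then have "Complex t s = 0" using XZ_indep by blast
    then have st: "s = 0" "t = 0" by (simp_all add: complex_eq_iff)
    obtain a W' where Y: "Y = a \<odot> V1 + W'" "T W' = 0" using T_rank by blast
    have "br W Y = Re a *\<^sub>R br W V1 - Im a *\<^sub>R br W (J V1) + br W W'"
      by (simp add: Y(1) act_def br_simps)
    also have "\<dots> \<in> g 2" using s t st g1_le_g2[OF ker_ker[OF W Y(2)]] by (intro g_closed) auto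
    finally show ?thesis .
  qed
  have "T (J V2) = 0" by (simp add: T_J V2(1))
  then have "br V2 Y \<in> g 2 \<and> br (J V2) Y \<in> g 2" for Y using ker_g2 V2(1) by blast
  moreover have "T V1 = 0 \<odot> V2 + 1 \<odot> X" by (simp add: TV1)
  moreover have "br X (J X) = 0" using X_ker[of "J X" 1] T_g2[OF X(2)] by simp
  ultimately have "adapted V1 V2"
    unfolding adapted_def using indep ker[OF T_derived] by blast
  then show ?thesis by (rule that)
qed

text \<open>As \<open>T\<close> is nilpotent there is \<open>V0\<close> with \<open>T V0 \<notin> M\<close> and \<open>T (T V0) \<in> M\<close>, so that \<open>V0\<close>, \<open>T V0\<close>, \<open>X\<close>, \<open>Z\<close>
  is a complex basis. A closed (1,0)-form confines the brackets to the complex span of the last three, which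
  is the situation of \<open>exists_image_T_in_g3\<close>; it allows replacing \<open>V0\<close> by \<open>V1\<close> such that \<open>V2 = T V1\<close>
  brackets into \<open>g 2\<close>. Applying \<open>T\<close> to \<open>[V1, J V1]\<close> and integrability extend this to \<open>J V2\<close>.
  Finally, if \<open>[X, J X]\<close> were not zero, then brackets lying in \<open>g 2\<close>, which commute with \<open>X\<close> and
  \<open>J X\<close>, would have no \<open>X\<close>-component, forcing \<open>V2\<close> into \<open>g 2\<close>.\<close>

lemma adapted_T_not_into_M:
  assumes TM: "T V \<notin> M"
  obtains V1 V2 where "adapted V1 V2"
proof -
  have T2: "\<exists>V. T V \<notin> M \<and> T (T V) \<in> M"
  proof -
    obtain j where j: "\<exists>W\<in>range T. W \<in> g (Suc j) \<and> W \<notin> M"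
      and least: "\<And>W. W \<in> range T \<Longrightarrow> W \<in> g j \<Longrightarrow> W \<in> M"
      using g_least[of "range T" M] TM M_closed(1) by blast
    then obtain V where V: "T V \<in> g (Suc j)" "T V \<notin> M" by blast
    have "T (T V) \<in> g j" using V(1) g_Suc br_anti[of "J Z" "T V"] g_closed(5) by metis
    then show ?thesis using least V(2) by blast
  qed
  have mod_M: "a = 0 \<and> b = 0" if V: "T V \<notin> M" "T (T V) \<in> M" and ab: "a \<odot> V + b \<odot> T V \<in> M" for V a b
  proof -
    obtain e where e: "T (T V) = e \<odot> X" using image_T_in_M[OF V(2)] .
    have "a \<odot> T V + b \<odot> T (T V) = 0" using T_vanishes_on_M[OF ab] by (simp add: br_simps T_act)
    then have "a \<odot> T V = (- b * e) \<odot> X + 0 \<odot> Z"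
      by (simp add: e act_mult act_minus_left add_eq_0_iff2)
    then have aT: "a \<odot> T V \<in> M" using MI by metis
    have cancel: "c = 0" if "c \<odot> T V \<in> M" for c
    proof (rule ccontr)
      assume "c \<noteq> 0"
      then have "T V = (1 / c) \<odot> (c \<odot> T V)" by (simp add: act_mult)
      then show False using M_act[OF that] V(1) by metis
    qed
    have "a = 0" by (rule cancel[OF aT])
    then show ?thesis using cancel[of b] ab by simp
  qed
  have TX: "T X = 0" by (rule T_g2[OF X(1)])
  obtain V0 where V0: "T V0 \<notin> M" "T (T V0) \<in> M" using T2 by blast
  note basis = complex_basis[OF complex_basis_mod_M[OF mod_M]]
  obtain e0 where e0: "T (T V0) = e0 \<odot> X" using image_T_in_M[OF V0(2)] .
  have TT: "T (T Y) \<in> g 2" for Y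
  proof -
    obtain a b c d where Y: "Y = a \<odot> V0 + b \<odot> T V0 + c \<odot> X + d \<odot> Z" by (rule basis[OF V0])
    have "T (T Y) = (a * e0) \<odot> X" by (simp add: Y br_simps T_act TX e0 act_mult)
    then show ?thesis using act_X_in_g2 by simp
  qed
  \<comment> \<open>The closed form found by \<open>closed_form_on_g2\<close> also kills \<open>T V\<close>, which is a bracket. So its
    kernel is spanned by \<open>T V\<close>, \<open>X\<close>, \<open>Z\<close>, and this kernel contains all brackets.\<close>
  have derived: "\<exists>b c d. br Y Y' = b \<odot> T V + c \<odot> X + d \<odot> Z"
    if V: "T V \<notin> M" "T (T V) \<in> M" for V Y Y'
  proof -
    have "V0 \<noteq> W + J W'" if "W \<in> g 2" "W' \<in> g 2" for W W'
    proof
      assume "V0 = W + J W'"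
      then have "V0 \<in> M" using M_closed(2)[OF g2_le_M[OF that(1)] M_J[OF g2_le_M[OF that(2)]]] by simp
      then show False using T_vanishes_on_M V0 M_closed(1) by metis
    qed
    then obtain \<omega> v where w: "\<omega> \<in> forms10 J" "\<omega> v \<noteq> 0" "\<And>X. X \<in> g 2 \<Longrightarrow> \<omega> X = 0" "\<And>X Y. \<omega> (br X Y) = 0"
      by (rule closed_form_on_g2[of V0]) blast+
    note [simp] = linear_add[OF forms10_D(1)[OF w(1)]] forms10_D(2,3)[OF w(1)]
    have [simp]: "\<omega> X = 0" "\<omega> Z = 0" using w(3)[OF X(1)] w(3)[OF Z_in_g2[of 1]] by auto
    obtain a b c d where v: "v = a \<odot> V + b \<odot> T V + c \<odot> X + d \<odot> Z" by (rule basis[OF V])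
    have "\<omega> V \<noteq> 0" using w(2) by (simp add: v w(4))
    moreover obtain a b c d where Y: "br Y Y' = a \<odot> V + b \<odot> T V + c \<odot> X + d \<odot> Z" by (rule basis[OF V])
    moreover have "a * \<omega> V = 0" using w(4)[of Y Y'] unfolding Y by (simp add: w(4))
    ultimately have "br Y Y' = b \<odot> T V + c \<odot> X + d \<odot> Z" by simp
    then show ?thesis by blast
  qed
  have D: "\<exists>V t. br Y Y' - T V - t *\<^sub>R J Z \<in> g 2" for Y Y'
  proof -
    obtain b c d where B: "br Y Y' = b \<odot> T V0 + c \<odot> X + d \<odot> Z" using derived[OF V0] by metis
    obtain t where "(c \<odot> X + d \<odot> Z) - t *\<^sub>R J Z \<in> g 2" using M_mod_JZ[OF MI] .
    moreover have "br Y Y' - T (b \<odot> V0) - t *\<^sub>R J Z = (c \<odot> X + d \<odot> Z) - t *\<^sub>R J Z"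
      by (simp add: B T_act)
    ultimately show ?thesis by metis
  qed
  have "T V0 \<notin> g 2" using V0(1) g2_le_M by blast
  then obtain V1 where V1: "T V1 \<notin> g 2" "\<And>Y. br (T V1) Y \<in> g 2"
    by (rule exists_image_T_in_g3[OF D]) blast
  define V2 where "V2 = T V1"
  have V1M: "T V1 \<notin> M" using V1(1) image_T_in_M act_X_in_g2 by metis
  note V1' = V1M g2_le_M[OF TT[of V1]]
  have V2_br: "br V2 Y \<in> g 2" for Y using V1(2) unfolding V2_def .
  have T_derived: "T (br Y Y') \<in> g 2" for Y Y'
  proof -
    obtain W t where W: "br Y Y' - T W - t *\<^sub>R J Z \<in> g 2" using D by metis
    have "T (br Y Y' - T W - t *\<^sub>R J Z) = 0" by (rule T_g2[OF W])
    then show ?thesis using TT[of W] by (simp add: br_simps)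
  qed
  have JV2V1: "br (J V2) V1 \<in> g 2"
  proof -
    have "br (J V2) V1 = br V2 (J V1) - T (br V1 (J V1))"
      using br_derivation[of "J Z" V1 "J V1"] br_anti[of V1 "J V2"] unfolding V2_def by (simp add: T_J)
    then show ?thesis using g_closed(3)[OF V2_br T_derived] by metis
  qed
  have JV2JV1: "br (J V2) (J V1) \<in> g 2"
  proof -
    have N: "br (J V2) (J V1) = br V2 V1 + J (br (J V2) V1 + br V2 (J V1))"
      using nijenhuis[of V2 V1] by (simp add: J_simps algebra_simps)
    have "br V2 V1 + J (br (J V2) V1 + br V2 (J V1)) \<in> M"
      by (intro M_closed(2,6) g2_le_M g_closed(2) V2_br JV2V1)
    then obtain t where t: "br (J V2) (J V1) - t *\<^sub>R J Z \<in> g 2" unfolding N[symmetric] by (rule M_mod_JZ)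
    obtain W where W: "br (J V1) (T (J V1)) - T W \<in> g 2" using bracket_image_T[OF D, of "J V1" "J V1"] by metis
    have "br (J V1) (T (J V1)) = - br (J V2) (J V1)" unfolding V2_def T_J by (rule br_anti)
    then have "T (- W) - t *\<^sub>R J Z = (br (J V2) (J V1) - t *\<^sub>R J Z) + (br (J V1) (T (J V1)) - T W)"
      by (simp add: br_simps)
    then have "t = 0" using g_closed(2)[OF t W] T_JZ_g2 by metis
    then show ?thesis using t by simp
  qed
  have TV2: "T V2 \<in> g 2" "T (J V2) \<in> g 2"
    using TT[of V1] TT[of "J V1"] unfolding V2_def T_J by auto
  have JV2_br: "br (J V2) Y \<in> g 2" for Y
  proof -
    obtain a b c d where Y: "Y = a \<odot> V1 + b \<odot> T V1 + c \<odot> X + d \<odot> Z" by (rule basis[OF V1'])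
    have "br (J V2) V2 \<in> g 2" using V2_br[of "J V2"] br_anti[of "J V2" V2] g_closed(5) by metis
    moreover have "br (J V2) (c \<odot> X) \<in> g 2" by (rule g1_le_g2[OF br_X_g1(2)])
    moreover have "br (J V2) Y = Re a *\<^sub>R br (J V2) V1 - Im a *\<^sub>R br (J V2) (J V1) + Re b *\<^sub>R br (J V2) V2
       + br (J V2) (c \<odot> X) + Im d *\<^sub>R T (J V2)"
      unfolding Y V2_def[symmetric] act_def[of J a] act_def[of J b] act_def[of J d] by (simp add: br_simps br_JZ)
    ultimately show ?thesis using JV2V1 JV2JV1 TV2 by (simp add: g_closed)
  qed
  have XJX: "br X (J X) = 0"
  proof -
    obtain t where t: "br X (J X) = t *\<^sub>R Z" using g2E[OF X(1)] .
    have "t = 0"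
    proof (rule ccontr)
      assume t0: "t \<noteq> 0"
      have "br V2 Y \<in> g 1" for Y
      proof -
        obtain c s where c: "br V2 Y = c \<odot> X + s *\<^sub>R Z" using g2_decompose[OF V2_br] .
        have "br X (br V2 Y) = (- Im c * t) *\<^sub>R Z" unfolding c act_def by (simp add: br_simps t)
        moreover have "br (J X) (br V2 Y) = (- Re c * t) *\<^sub>R Z"
          unfolding c act_def using br_anti[of "J X" X] by (simp add: br_simps t)
        ultimately have "Im c * t = 0" "Re c * t = 0"
          using g2_centralizes_derived[OF X(1), of V2 Y] g2_centralizes_derived[OF X(2), of V2 Y] Z by auto
        then have "c = 0" using t0 by (simp add: complex_eq_iff)
        then show ?thesis using c scaleR_Z_in_g1 by simp
      qed
      then have "V2 \<in> g 2" unfolding g2_iff by blast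
      then show False using V1(1) unfolding V2_def by blast
    qed
    then show ?thesis using t by simp
  qed
  have "T V1 = 1 \<odot> V2 + 0 \<odot> X" by (simp add: V2_def)
  moreover have "\<exists>b c d. br V1 (J V1) = b \<odot> V2 + c \<odot> X + d \<odot> Z"
    using derived[OF V1'] unfolding V2_def by blast
  moreover have "a = 0 \<and> b = 0 \<and> c = 0 \<and> d = 0" if "a \<odot> V1 + b \<odot> V2 + c \<odot> X + d \<odot> Z = 0" for a b c d
    using complex_basis_mod_M[OF mod_M[OF V1']] that unfolding V2_def by blast
  ultimately have "adapted V1 V2"
    unfolding adapted_def using V2_br JV2_br XJX by blast
  then show ?thesis by (rule that)
qed

end
end

section \<open>From an adapted basis to the structure equations\<close>

context nilpotent_complex_lie_algebra begin

lemma forms10_subspace: "cform.subspace (forms10 J)"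
  unfolding cform.subspace_def
proof (intro conjI ballI allI)
  show "0 \<in> forms10 J" by (auto simp: forms10_def intro!: linearI)
next
  fix \<alpha> \<beta> assume a: "\<alpha> \<in> forms10 J" and b: "\<beta> \<in> forms10 J"
  show "\<alpha> + \<beta> \<in> forms10 J"
    using forms10_D(2)[OF a] forms10_D(2)[OF b] linear_compose_add[OF forms10_D(1)[OF a] forms10_D(1)[OF b]]
    by (auto simp: forms10_def plus_fun_def algebra_simps)
next
  fix c \<alpha> assume a: "\<alpha> \<in> forms10 J"
  have "linear (\<lambda>X. c * \<alpha> X)"
    by (rule linearI) (simp_all add: linear_add[OF forms10_D(1)[OF a]] linear_scale[OF forms10_D(1)[OF a]] algebra_simps)
  then show "cscale c \<alpha> \<in> forms10 J"
    using forms10_D(2)[OF a] by (auto simp: forms10_def cscale_def algebra_simps)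
qed

lemma span_vanishes:
  assumes "\<omega> \<in> cform.span S" "\<And>\<alpha>. \<alpha> \<in> S \<Longrightarrow> \<alpha> v = 0"
  shows "\<omega> v = 0"
  using assms(1)
proof (induction rule: cform.span_induct_alt)
  case (step c x y)
  then show ?case using assms(2) by (simp add: cscale_def)
qed simp

lemma dual_basis10:
  assumes w: "\<omega>1 \<in> forms10 J" "\<omega>2 \<in> forms10 J" "\<omega>3 \<in> forms10 J" "\<omega>4 \<in> forms10 J"
    and dual: "\<omega>1 V1 = 1" "\<omega>1 V2 = 0" "\<omega>1 V3 = 0" "\<omega>1 V4 = 0"
      "\<omega>2 V1 = 0" "\<omega>2 V2 = 1" "\<omega>2 V3 = 0" "\<omega>2 V4 = 0"
      "\<omega>3 V1 = 0" "\<omega>3 V2 = 0" "\<omega>3 V3 = 1" "\<omega>3 V4 = 0"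
      "\<omega>4 V1 = 0" "\<omega>4 V2 = 0" "\<omega>4 V3 = 0" "\<omega>4 V4 = 1"
    and coords: "\<And>Y. Y = \<omega>1 Y \<odot> V1 + \<omega>2 Y \<odot> V2 + \<omega>3 Y \<odot> V3 + \<omega>4 Y \<odot> V4"
  shows "basis10 J \<omega>1 \<omega>2 \<omega>3 \<omega>4"
  unfolding basis10_def
proof (intro conjI)
  show "distinct [\<omega>1, \<omega>2, \<omega>3, \<omega>4]" using dual by auto
  have "\<omega>1 \<notin> cform.span {\<omega>2, \<omega>3, \<omega>4}" using span_vanishes[of \<omega>1 "{\<omega>2, \<omega>3, \<omega>4}" V1] dual by auto
  moreover have "\<omega>2 \<notin> cform.span {\<omega>3, \<omega>4}" using span_vanishes[of \<omega>2 "{\<omega>3, \<omega>4}" V2] dual by auto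
  moreover have "\<omega>3 \<notin> cform.span {\<omega>4}" using span_vanishes[of \<omega>3 "{\<omega>4}" V3] dual by auto
  moreover have "\<omega>4 \<notin> cform.span {}" using span_vanishes[of \<omega>4 "{}" V4] dual by auto
  ultimately show "cform.independent {\<omega>1, \<omega>2, \<omega>3, \<omega>4}"
    by (intro cform.independent_insertI) (auto simp: cform.independent_empty)
  show "cform.span {\<omega>1, \<omega>2, \<omega>3, \<omega>4} = forms10 J"
  proof
    show "cform.span {\<omega>1, \<omega>2, \<omega>3, \<omega>4} \<subseteq> forms10 J"
      using w by (intro cform.span_minimal forms10_subspace) auto
    show "forms10 J \<subseteq> cform.span {\<omega>1, \<omega>2, \<omega>3, \<omega>4}"
    proof
      fix \<omega> assume \<omega>: "\<omega> \<in> forms10 J"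
      have expand: "\<omega> Y = \<omega> V1 * \<omega>1 Y + \<omega> V2 * \<omega>2 Y + \<omega> V3 * \<omega>3 Y + \<omega> V4 * \<omega>4 Y" for Y
      proof -
        have "\<omega> Y = \<omega> (\<omega>1 Y \<odot> V1 + \<omega>2 Y \<odot> V2 + \<omega>3 Y \<odot> V3 + \<omega>4 Y \<odot> V4)"
          by (rule arg_cong[OF coords])
        then show ?thesis
          by (simp add: linear_add[OF forms10_D(1)[OF \<omega>]] forms10_D(3)[OF \<omega>] mult.commute)
      qed
      have "\<omega> = cscale (\<omega> V1) \<omega>1 + cscale (\<omega> V2) \<omega>2 + cscale (\<omega> V3) \<omega>3 + cscale (\<omega> V4) \<omega>4"
        by (rule ext, rule trans[OF expand]) (simp add: cscale_def)
      also have "\<dots> \<in> cform.span {\<omega>1, \<omega>2, \<omega>3, \<omega>4}"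
        by (intro cform.span_add cform.span_scale cform.span_base) auto
      finally show "\<omega> \<in> cform.span {\<omega>1, \<omega>2, \<omega>3, \<omega>4}" .
    qed
  qed
qed

text \<open>This is the Jacobi identity.\<close>

lemma d2_d1_zero:
  assumes "linear \<omega>"
  shows "d2 br (d1 br \<omega>) X Y W = 0"
proof -
  have 1: "br (br X Y) W = - br W (br X Y)" by (rule br_anti)
  have 2: "br (br W X) Y = - br (br X W) Y"
    by (simp only: br_anti[of W X] br_simps)
  have 3: "br X (br W Y) = br (br Y W) X"
    using br_anti[of X "br W Y"] unfolding br_anti[of W Y] by (simp add: br_simps)
  have "br (br X Y) W - br (br X W) Y + br (br Y W) X = 0"
    unfolding 1 br_derivation[of W X Y] 2 3 by simp
  then have "\<omega> (br (br X Y) W) - \<omega> (br (br X W) Y) + \<omega> (br (br Y W) X) = 0"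
    using linear_add[OF assms] linear_diff[OF assms] linear_0[OF assms] by metis
  then show ?thesis by (simp add: d2_def d1_def algebra_simps)
qed

lemma br_act_same: "br (z \<odot> V) (w \<odot> V) = Im (z * cnj w) *\<^sub>R br V (J V)"
proof -
  have "br (z \<odot> V) (w \<odot> V) = (- (Re z * Im w)) *\<^sub>R br V (J V) - (Im z * Re w) *\<^sub>R br (J V) V"
    by (simp add: act_def br_simps mult.commute)
  also have "\<dots> = Im (z * cnj w) *\<^sub>R br V (J V)"
    unfolding br_anti[of "J V" V] by (simp add: algebra_simps)
  finally show ?thesis .
qed

text \<open>The differential of a (1,0)-form has no component of type (0,2), so there is no term with
  \<open>cnj z * cnj w\<close>.\<close>

lemma form10_br_act:
  assumes w: "\<omega> \<in> forms10 J"
  shows "\<omega> (br (z \<odot> U) (w \<odot> V)) =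
    \<i> * (\<omega> (br (J U) V) + \<omega> (br U (J V))) / 2 * (z * w)
    + (\<omega> (br U V) - \<i> * \<omega> (br U (J V))) / 2 * (z * cnj w)
    + (\<omega> (br U V) - \<i> * \<omega> (br (J U) V)) / 2 * (cnj z * w)"
proof -
  note l = linear_add[OF forms10_D(1)[OF w]] linear_diff[OF forms10_D(1)[OF w]] linear_scale[OF forms10_D(1)[OF w]]
    linear_neg[OF forms10_D(1)[OF w]] linear_0[OF forms10_D(1)[OF w]] forms10_D(2)[OF w]
  define a b c d where "a = \<omega> (br U V)" and "b = \<omega> (br (J U) V)" and "c = \<omega> (br U (J V))" and "d = \<omega> (br (J U) (J V))"
  have "\<omega> (br U V + J (br (J U) V) + J (br U (J V)) - br (J U) (J V)) = 0"
    by (simp add: nijenhuis l)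
  then have d: "d = a - \<i> * b - \<i> * c" by (simp add: l a_def b_def c_def d_def)
  have "\<omega> (br (z \<odot> U) (w \<odot> V)) = of_real (Re z * Re w) * a - of_real (Re z * Im w) * c
      - of_real (Im z * Re w) * b + of_real (Im z * Im w) * d"
    by (simp add: act_def br_simps l a_def b_def c_def d_def scaleR_conv_of_real algebra_simps)
  also have "\<dots> = \<i> * (b + c) / 2 * (z * w) + (a - \<i> * c) / 2 * (z * cnj w) + (a - \<i> * b) / 2 * (cnj z * w)"
    unfolding d by (simp add: complex_eq_iff field_simps)
  finally show ?thesis unfolding a_def b_def c_def .
qed

end

context snn_eight begin

lemma br_act_Z: "br (z \<odot> U) (w \<odot> Z) = Im w *\<^sub>R (z \<odot> T U)"
  unfolding act_def[of J w] by (simp add: br_simps br_JZ T_act)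

text \<open>The pairs of basis lines without a term contribute nothing: \<open>Z\<close> is central, \<open>[X, J X] = 0\<close> and
  \<open>T X = 0\<close>. In a pair with \<open>Z\<close> only the \<open>J Z\<close>-component, that is the imaginary part of the
  coordinate, matters.\<close>

lemma bracket_in_basis:
  assumes X: "X \<in> g 2" "J X \<in> g 2" "br X (J X) = 0"
    and Y: "Y = z1 \<odot> V1 + z2 \<odot> V2 + z3 \<odot> X + z4 \<odot> Z"
    and Y': "Y' = w1 \<odot> V1 + w2 \<odot> V2 + w3 \<odot> X + w4 \<odot> Z"
  shows "br Y Y' = Im (z1 * cnj w1) *\<^sub>R br V1 (J V1) + Im (z2 * cnj w2) *\<^sub>R br V2 (J V2)
    + (br (z1 \<odot> V1) (w2 \<odot> V2) - br (w1 \<odot> V1) (z2 \<odot> V2))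
    + (br (z1 \<odot> V1) (w3 \<odot> X) - br (w1 \<odot> V1) (z3 \<odot> X))
    + (br (z2 \<odot> V2) (w3 \<odot> X) - br (w2 \<odot> V2) (z3 \<odot> X))
    + (of_real (Im w4) * z1 - of_real (Im z4) * w1) \<odot> T V1
    + (of_real (Im w4) * z2 - of_real (Im z4) * w2) \<odot> T V2"
proof -
  have TX: "T X = 0" by (rule T_g2[OF X(1)])
  have anti: "br (z2 \<odot> V2) (w1 \<odot> V1) = - br (w1 \<odot> V1) (z2 \<odot> V2)"
    "br (z3 \<odot> X) (w1 \<odot> V1) = - br (w1 \<odot> V1) (z3 \<odot> X)"
    "br (z3 \<odot> X) (w2 \<odot> V2) = - br (w2 \<odot> V2) (z3 \<odot> X)"
    "br (z4 \<odot> Z) (w1 \<odot> V1) = - br (w1 \<odot> V1) (z4 \<odot> Z)"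
    "br (z4 \<odot> Z) (w2 \<odot> V2) = - br (w2 \<odot> V2) (z4 \<odot> Z)"
    "br (z4 \<odot> Z) (w3 \<odot> X) = - br (w3 \<odot> X) (z4 \<odot> Z)"
    by (rule br_anti)+
  show ?thesis
    unfolding Y Y'
    by (simp add: bilinear_ladd[OF bil] bilinear_radd[OF bil] anti br_act_same br_act_Z X(3) TX
        act_diff_left act_scaleR')
qed

text \<open>The forms are the coordinates with respect to \<open>V1\<close>, \<open>V2\<close>, \<open>X\<close>, \<open>Z\<close>, and their differentials are read
  off from \<open>bracket_in_basis\<close>.\<close>

lemma structure_equations_of_adapted:
  assumes X: "X \<in> g 2" "J X \<in> g 2" "X \<noteq> 0" and ad: "adapted X V1 V2"
  obtains \<omega>1 \<omega>2 \<omega>3 \<omega>4 A B C D E F G H K L M N P s where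
    "basis10 J \<omega>1 \<omega>2 \<omega>3 \<omega>4"
    "structure_equations br \<omega>1 \<omega>2 \<omega>3 \<omega>4 A B C D E F G H K L M N P s"
proof -
  have indep: "\<And>a b c d. a \<odot> V1 + b \<odot> V2 + c \<odot> X + d \<odot> Z = 0 \<Longrightarrow> a = 0 \<and> b = 0 \<and> c = 0 \<and> d = 0"
    and V2: "\<And>Y. br V2 Y \<in> g 2" "\<And>Y. br (J V2) Y \<in> g 2" and XJX: "br X (J X) = 0"
    using ad unfolding adapted_def[OF X] by blast+
  obtain b e where TV1: "T V1 = b \<odot> V2 + e \<odot> X" using ad unfolding adapted_def[OF X] by blast
  obtain a1 a2 a3 where V11: "br V1 (J V1) = a1 \<odot> V2 + a2 \<odot> X + a3 \<odot> Z" using ad unfolding adapted_def[OF X] by blast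
  have "T V2 \<in> g 2" using V2(1)[of "J Z"] br_anti[of "J Z" V2] g_closed(5) by metis
  then obtain h where TV2: "T V2 = h \<odot> X" using image_T_in_M[OF X g2_le_M[OF X]] by metis
  have "\<forall>Y. \<exists>p. Y = fst p \<odot> V1 + fst (snd p) \<odot> V2 + fst (snd (snd p)) \<odot> X + snd (snd (snd p)) \<odot> Z"
  proof
    fix Y
    obtain a b c d where "Y = a \<odot> V1 + b \<odot> V2 + c \<odot> X + d \<odot> Z" by (rule complex_basis[OF indep])
    then show "\<exists>p. Y = fst p \<odot> V1 + fst (snd p) \<odot> V2 + fst (snd (snd p)) \<odot> X + snd (snd (snd p)) \<odot> Z"
      by (intro exI[of _ "(a, b, c, d)"]) simp
  qed
  then obtain p where p: "\<And>Y. Y = fst (p Y) \<odot> V1 + fst (snd (p Y)) \<odot> V2 + fst (snd (snd (p Y))) \<odot> X + snd (snd (snd (p Y))) \<odot> Z"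
    by metis
  define \<omega>1 \<omega>2 \<omega>3 \<omega>4 where w_def: "\<omega>1 = (\<lambda>Y. fst (p Y))" "\<omega>2 = (\<lambda>Y. fst (snd (p Y)))"
    "\<omega>3 = (\<lambda>Y. fst (snd (snd (p Y))))" "\<omega>4 = (\<lambda>Y. snd (snd (snd (p Y))))"
  have coords: "Y = \<omega>1 Y \<odot> V1 + \<omega>2 Y \<odot> V2 + \<omega>3 Y \<odot> X + \<omega>4 Y \<odot> Z" for Y
    unfolding w_def by (rule p)
  have uniq: "\<omega>1 Y = a \<and> \<omega>2 Y = b \<and> \<omega>3 Y = c \<and> \<omega>4 Y = d" if "Y = a \<odot> V1 + b \<odot> V2 + c \<odot> X + d \<odot> Z" for Y a b c d
  proof -
    have "(\<omega>1 Y - a) \<odot> V1 + (\<omega>2 Y - b) \<odot> V2 + (\<omega>3 Y - c) \<odot> X + (\<omega>4 Y - d) \<odot> Z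
      = (\<omega>1 Y \<odot> V1 + \<omega>2 Y \<odot> V2 + \<omega>3 Y \<odot> X + \<omega>4 Y \<odot> Z) - (a \<odot> V1 + b \<odot> V2 + c \<odot> X + d \<odot> Z)"
      by (simp add: act_diff_left)
    also have "\<dots> = Y - Y" by (simp only: coords[symmetric] that[symmetric])
    finally show ?thesis using indep[of "\<omega>1 Y - a" "\<omega>2 Y - b" "\<omega>3 Y - c" "\<omega>4 Y - d"] by simp
  qed
  have add: "\<omega>1 (Y + Y') = \<omega>1 Y + \<omega>1 Y' \<and> \<omega>2 (Y + Y') = \<omega>2 Y + \<omega>2 Y' \<and> \<omega>3 (Y + Y') = \<omega>3 Y + \<omega>3 Y' \<and> \<omega>4 (Y + Y') = \<omega>4 Y + \<omega>4 Y'" for Y Y'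
  proof (rule uniq)
    have "Y + Y' = (\<omega>1 Y \<odot> V1 + \<omega>2 Y \<odot> V2 + \<omega>3 Y \<odot> X + \<omega>4 Y \<odot> Z) + (\<omega>1 Y' \<odot> V1 + \<omega>2 Y' \<odot> V2 + \<omega>3 Y' \<odot> X + \<omega>4 Y' \<odot> Z)"
      by (simp only: coords[symmetric])
    then show "Y + Y' = (\<omega>1 Y + \<omega>1 Y') \<odot> V1 + (\<omega>2 Y + \<omega>2 Y') \<odot> V2 + (\<omega>3 Y + \<omega>3 Y') \<odot> X + (\<omega>4 Y + \<omega>4 Y') \<odot> Z"
      by (simp add: act_add_left)
  qed
  have act: "\<omega>1 (c \<odot> Y) = c * \<omega>1 Y \<and> \<omega>2 (c \<odot> Y) = c * \<omega>2 Y \<and> \<omega>3 (c \<odot> Y) = c * \<omega>3 Y \<and> \<omega>4 (c \<odot> Y) = c * \<omega>4 Y" for c Y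
  proof (rule uniq)
    have "c \<odot> Y = c \<odot> (\<omega>1 Y \<odot> V1 + \<omega>2 Y \<odot> V2 + \<omega>3 Y \<odot> X + \<omega>4 Y \<odot> Z)"
      by (simp only: coords[symmetric])
    then show "c \<odot> Y = (c * \<omega>1 Y) \<odot> V1 + (c * \<omega>2 Y) \<odot> V2 + (c * \<omega>3 Y) \<odot> X + (c * \<omega>4 Y) \<odot> Z"
      by (simp add: act_add_right act_mult)
  qed
  have form: "\<omega> \<in> forms10 J" if "\<And>Y Y'. \<omega> (Y + Y') = \<omega> Y + \<omega> Y'" "\<And>c Y. \<omega> (c \<odot> Y) = c * \<omega> Y" for \<omega>
  proof -
    have "\<omega> (r *\<^sub>R Y) = r *\<^sub>R \<omega> Y" for r Y
      using that(2)[of "of_real r" Y] by (simp only: act_of_real scaleR_conv_of_real)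
    then have "linear \<omega>" using that(1) by (intro linearI)
    moreover have "\<omega> (J Y) = - \<i> * \<omega> Y" for Y
      using that(2)[of "- \<i>" Y] J_as_act[of Y] by metis
    ultimately show ?thesis unfolding forms10_def by blast
  qed
  have w: "\<omega>1 \<in> forms10 J" "\<omega>2 \<in> forms10 J" "\<omega>3 \<in> forms10 J" "\<omega>4 \<in> forms10 J"
    by (rule form; simp add: add act)+
  have val: "\<omega>1 V1 = 1 \<and> \<omega>2 V1 = 0 \<and> \<omega>3 V1 = 0 \<and> \<omega>4 V1 = 0"
    "\<omega>1 V2 = 0 \<and> \<omega>2 V2 = 1 \<and> \<omega>3 V2 = 0 \<and> \<omega>4 V2 = 0"
    "\<omega>1 X = 0 \<and> \<omega>2 X = 0 \<and> \<omega>3 X = 1 \<and> \<omega>4 X = 0"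
    "\<omega>1 Z = 0 \<and> \<omega>2 Z = 0 \<and> \<omega>3 Z = 0 \<and> \<omega>4 Z = 1"
    by (rule uniq, simp)+
  have basis: "basis10 J \<omega>1 \<omega>2 \<omega>3 \<omega>4"
    using dual_basis10[OF w _ _ _ _ _ _ _ _ _ _ _ _ _ _ _ _ coords] val by blast
  have scale: "\<omega> (r *\<^sub>R Y) = of_real r * \<omega> Y" if "\<omega> \<in> forms10 J" for \<omega> r Y
    using linear_scale[OF forms10_D(1)[OF that]] by (simp add: scaleR_conv_of_real)
  have diff: "\<omega> (Y - Y') = \<omega> Y - \<omega> Y'" if "\<omega> \<in> forms10 J" for \<omega> Y Y'
    using linear_diff[OF forms10_D(1)[OF that]] .
  have on_g2: "\<omega>1 W = 0" "\<omega>2 W = 0" "Im (\<omega>4 W) = 0" if W: "W \<in> g 2" for W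
  proof -
    obtain c t where "W = c \<odot> X + t *\<^sub>R Z" using g2_decompose[OF X W] .
    then show "\<omega>1 W = 0" "\<omega>2 W = 0" "Im (\<omega>4 W) = 0" using add act val scale[OF w(1)] scale[OF w(2)] scale[OF w(4)] by auto
  qed
  have on_g1: "\<omega>3 W = 0" if "W \<in> g 1" for W
    using that scale[OF w(3), of _ Z] val unfolding g1 by auto
  \<comment> \<open>Where \<open>d \<omega>4\<close> is real it equals its conjugate; having no (0,2)-part it then has no (2,0)-part
    either, and its two (1,1)-coefficients are conjugate. This produces the pairs \<open>M\<close>, \<open>- cnj M\<close> etc.\<close>
  have real_block: "\<exists>Q. \<forall>z w. \<omega>4 (br (z \<odot> U) (w \<odot> V)) = Q * (z * cnj w) + cnj Q * (cnj z * w)"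
    if re: "Im (\<omega>4 (br U V)) = 0" "Im (\<omega>4 (br (J U) V)) = 0" "Im (\<omega>4 (br U (J V))) = 0" "Im (\<omega>4 (br (J U) (J V))) = 0" for U V
  proof -
    have "\<omega>4 (br U V + J (br (J U) V) + J (br U (J V)) - br (J U) (J V)) = 0"
      by (simp add: nijenhuis linear_0[OF forms10_D(1)[OF w(4)]])
    then have "\<omega>4 (br U V) - \<i> * \<omega>4 (br (J U) V) - \<i> * \<omega>4 (br U (J V)) - \<omega>4 (br (J U) (J V)) = 0"
      using add diff[OF w(4)] forms10_D(2)[OF w(4)] by simp
    then have bc: "Re (\<omega>4 (br (J U) V)) = - Re (\<omega>4 (br U (J V)))" using re by (simp add: complex_eq_iff)
    let ?Q = "(\<omega>4 (br U V) - \<i> * \<omega>4 (br U (J V))) / 2"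
    have e: "\<i> * (\<omega>4 (br (J U) V) + \<omega>4 (br U (J V))) / 2 = 0"
      "(\<omega>4 (br U V) - \<i> * \<omega>4 (br (J U) V)) / 2 = cnj ?Q"
      using re bc by (simp_all add: complex_eq_iff)
    have "\<omega>4 (br (z \<odot> U) (w \<odot> V)) = ?Q * (z * cnj w) + cnj ?Q * (cnj z * w)" for z w
      unfolding form10_br_act[OF w(4), of z U w V] e by simp
    then show ?thesis by blast
  qed
  have anti2: "br Y V2 \<in> g 2" "br Y (J V2) \<in> g 2" for Y
    using V2 br_anti[of Y V2] br_anti[of Y "J V2"] g_closed(5) by metis+
  obtain Q12 where Q12: "\<And>z w. \<omega>4 (br (z \<odot> V1) (w \<odot> V2)) = Q12 * (z * cnj w) + cnj Q12 * (cnj z * w)"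
    using real_block[of V1 V2] on_g2(3) anti2 by blast
  obtain Q13 where Q13: "\<And>z w. \<omega>4 (br (z \<odot> V1) (w \<odot> X)) = Q13 * (z * cnj w) + cnj Q13 * (cnj z * w)"
    using real_block[of V1 X] on_g2(3) g2_bracket'(2)[OF X(1)] g2_bracket'(2)[OF X(2)] by blast
  obtain Q23 where Q23: "\<And>z w. \<omega>4 (br (z \<odot> V2) (w \<odot> X)) = Q23 * (z * cnj w) + cnj Q23 * (cnj z * w)"
    using real_block[of V2 X] on_g2(3) g2_bracket'(2)[OF X(1)] g2_bracket'(2)[OF X(2)] by blast
  obtain p q r where pqr: "\<And>z w. \<omega>3 (br (z \<odot> V1) (w \<odot> V2)) = p * (z * w) + q * (z * cnj w) + r * (cnj z * w)"
    using form10_br_act[OF w(3), of _ V1 _ V2] by blast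
  have blocks12: "\<omega>1 (br Y (c \<odot> V2)) = 0" "\<omega>2 (br Y (c \<odot> V2)) = 0" for Y c
  proof -
    have "br Y (c \<odot> V2) \<in> g 2" unfolding act_def using anti2 by (simp add: br_simps g_closed)
    then show "\<omega>1 (br Y (c \<odot> V2)) = 0" "\<omega>2 (br Y (c \<odot> V2)) = 0" using on_g2 by auto
  qed
  have blocks3: "\<omega>1 (br Y (c \<odot> X)) = 0" "\<omega>2 (br Y (c \<odot> X)) = 0" "\<omega>3 (br Y (c \<odot> X)) = 0" for Y c
    using br_X_g1(2)[OF X] on_g1 on_g2(1,2) g1_le_g2 by blast+
  have V22: "\<omega>1 (br V2 (J V2)) = 0" "\<omega>2 (br V2 (J V2)) = 0" "\<omega>4 (br V2 (J V2)) = of_real (Re (\<omega>4 (br V2 (J V2))))"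
    using on_g2[OF V2(1), of "J V2"] by (simp_all add: complex_eq_iff)
  note expand = bracket_in_basis[OF X(1,2) XJX coords coords]
  define k l where "k = \<omega>3 (br V2 (J V2))" and "l = Re (\<omega>4 (br V2 (J V2)))"
  have Im_conv: "of_real (Im z) = (z - cnj z) / (2 * \<i>)" for z
    by (simp add: complex_eq_iff)
  have eq1: "\<omega>1 (br Y Y') = 0" for Y Y'
    unfolding expand[of Y Y'] using add act val
    by (simp add: diff[OF w(1)] scale[OF w(1)] V11 TV1 TV2 blocks12 blocks3 V22)
  have eq2: "\<omega>2 (br Y Y') = of_real (Im (\<omega>1 Y * cnj (\<omega>1 Y'))) * a1
      + (of_real (Im (\<omega>4 Y')) * \<omega>1 Y - of_real (Im (\<omega>4 Y)) * \<omega>1 Y') * b" for Y Y'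
    unfolding expand[of Y Y'] using add act val
    by (simp add: diff[OF w(2)] scale[OF w(2)] V11 TV1 TV2 blocks12 blocks3 V22)
  have eq3: "\<omega>3 (br Y Y') = of_real (Im (\<omega>1 Y * cnj (\<omega>1 Y'))) * a2 + of_real (Im (\<omega>2 Y * cnj (\<omega>2 Y'))) * k
      + (p * (\<omega>1 Y * \<omega>2 Y') + q * (\<omega>1 Y * cnj (\<omega>2 Y')) + r * (cnj (\<omega>1 Y) * \<omega>2 Y')
        - (p * (\<omega>1 Y' * \<omega>2 Y) + q * (\<omega>1 Y' * cnj (\<omega>2 Y)) + r * (cnj (\<omega>1 Y') * \<omega>2 Y)))
      + (of_real (Im (\<omega>4 Y')) * \<omega>1 Y - of_real (Im (\<omega>4 Y)) * \<omega>1 Y') * e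
      + (of_real (Im (\<omega>4 Y')) * \<omega>2 Y - of_real (Im (\<omega>4 Y)) * \<omega>2 Y') * h" for Y Y'
    unfolding expand[of Y Y'] using add act val
    by (simp add: diff[OF w(3)] scale[OF w(3)] V11 TV1 TV2 blocks3 k_def pqr)
  have eq4: "\<omega>4 (br Y Y') = of_real (Im (\<omega>1 Y * cnj (\<omega>1 Y'))) * a3 + of_real (Im (\<omega>2 Y * cnj (\<omega>2 Y'))) * of_real l
      + (Q12 * (\<omega>1 Y * cnj (\<omega>2 Y')) + cnj Q12 * (cnj (\<omega>1 Y) * \<omega>2 Y')
        - (Q12 * (\<omega>1 Y' * cnj (\<omega>2 Y)) + cnj Q12 * (cnj (\<omega>1 Y') * \<omega>2 Y)))
      + (Q13 * (\<omega>1 Y * cnj (\<omega>3 Y')) + cnj Q13 * (cnj (\<omega>1 Y) * \<omega>3 Y')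
        - (Q13 * (\<omega>1 Y' * cnj (\<omega>3 Y)) + cnj Q13 * (cnj (\<omega>1 Y') * \<omega>3 Y)))
      + (Q23 * (\<omega>2 Y * cnj (\<omega>3 Y')) + cnj Q23 * (cnj (\<omega>2 Y) * \<omega>3 Y')
        - (Q23 * (\<omega>2 Y' * cnj (\<omega>3 Y)) + cnj Q23 * (cnj (\<omega>2 Y') * \<omega>3 Y)))" for Y Y'
    unfolding expand[of Y Y'] using add act val V22(3)[folded l_def]
    by (simp add: diff[OF w(4)] scale[OF w(4)] V11 TV1 TV2 Q12 Q13 Q23)
  \<comment> \<open>Since \<open>Im u = (u - cnj u) / (2 \<i>)\<close>, coefficients of imaginary parts acquire a factor \<open>\<plusminus> \<i> / 2\<close>. The third
    differential has three independent coefficients \<open>- p\<close>, \<open>- q\<close>, \<open>r\<close>, to be written as \<open>C - D\<close>,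
    \<open>G + D\<close>, \<open>C - G\<close>.\<close>
  have "structure_equations br \<omega>1 \<omega>2 \<omega>3 \<omega>4 (\<i> * a1 / 2) (- \<i> * b / 2)
      ((- p - q + r) / 2) ((p - q + r) / 2) (- \<i> * e / 2) (\<i> * a2 / 2) ((- p - q - r) / 2)
      (- \<i> * h / 2) (\<i> * k / 2) (\<i> * a3 / 2) (- Q12) (- Q13) (- Q23) (l / 2)"
    unfolding structure_equations_def d1_def wedge_def cbar_def eq1 eq2 eq3 eq4 Im_conv
    by (simp add: field_simps)
  with basis show ?thesis by (rule that)
qed

end

section \<open>The coefficients for each ascending type\<close>

lemma (in nilpotent_lie_algebra) ascending_type_nth:
  assumes "ascending_type br = ds" "dim (UNIV :: 'a set) > 0"
  shows "g (length ds) = UNIV" "k < length ds \<Longrightarrow> dim (g (Suc k)) = ds ! k"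
proof -
  have len: "length ds = nil_step br" using assms(1) by (auto simp: ascending_type_def)
  obtain r where r: "g r = UNIV" by (rule g_top)
  then have "1 \<le> Suc r \<and> g (Suc r) = UNIV" using g_mono_Suc[of r] by auto
  then show "g (length ds) = UNIV" unfolding len nil_step_def by (rule LeastI2) simp
  assume k: "k < length ds"
  have "ds ! k = dim (g ([1..<Suc (nil_step br)] ! k))"
    unfolding assms(1)[symmetric] ascending_type_def using k len by (intro nth_map) simp
  then show "dim (g (Suc k)) = ds ! k" using k len by (simp add: nth_upt del: upt_Suc)
qed

text \<open>A nonzero vector is detected by some real functional, hence by some (1,0)-form.\<close>

lemma (in nilpotent_complex_lie_algebra) basis10_separates:
  assumes b: "basis10 J \<omega>1 \<omega>2 \<omega>3 \<omega>4" and 0: "\<omega>1 Y = 0" "\<omega>2 Y = 0" "\<omega>3 Y = 0" "\<omega>4 Y = 0"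
  shows "Y = 0"
proof (rule ccontr)
  assume Y: "Y \<noteq> 0"
  obtain f :: "'a \<Rightarrow> real" where f: "linear f" "f Y = 1"
    using separating_functional[of "{0}" Y] Y by auto
  have "(\<lambda>X. Complex (f (J X)) (- f X)) \<in> cform.span {\<omega>1, \<omega>2, \<omega>3, \<omega>4}"
    using form10_of_functional[OF f(1)] b by (simp add: basis10_def)
  then have "Complex (f (J Y)) (- f Y) = 0"
    by (rule span_vanishes) (use 0 in auto)
  then show False using f(2) by (simp add: complex_eq_iff)
qed

text \<open>The four forms are jointly injective and both sides have real dimension eight.\<close>

lemma (in snn_eight) basis10_coordinates:
  assumes b: "basis10 J \<omega>1 \<omega>2 \<omega>3 \<omega>4"
  shows "\<exists>Y. \<omega>1 Y = a \<and> \<omega>2 Y = b \<and> \<omega>3 Y = c \<and> \<omega>4 Y = d"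
proof -
  have "{\<omega>1, \<omega>2, \<omega>3, \<omega>4} \<subseteq> forms10 J"
    using b cform.span_superset[of "{\<omega>1, \<omega>2, \<omega>3, \<omega>4}"] by (simp add: basis10_def)
  then have forms_linear: "linear \<omega>1" "linear \<omega>2" "linear \<omega>3" "linear \<omega>4" using forms10_D(1) by auto
  define \<phi> where "\<phi> Y = (\<omega>1 Y, \<omega>2 Y, \<omega>3 Y, \<omega>4 Y)" for Y
  have \<phi>: "linear \<phi>"
    by (rule linearI) (simp_all add: \<phi>_def linear_add[OF forms_linear(1)] linear_add[OF forms_linear(2)] linear_add[OF forms_linear(3)]
        linear_add[OF forms_linear(4)] linear_scale[OF forms_linear(1)] linear_scale[OF forms_linear(2)] linear_scale[OF forms_linear(3)] linear_scale[OF forms_linear(4)])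
  have "Y = 0" if "\<phi> Y = 0" for Y
    using that basis10_separates[OF b] by (simp add: \<phi>_def zero_prod_def)
  then have inj: "inj \<phi>" using \<phi> by (simp add: linear_injective_0)
  obtain B where B: "B \<subseteq> (UNIV :: 'a set)" "independent B" "UNIV \<subseteq> span B" "card B = dim (UNIV :: 'a set)"
    by (rule basis_exists[of UNIV])
  have "independent (\<phi> ` B)"
    using linear_independent_injective_image[OF \<phi> B(2)] inj by (meson inj_on_subset subset_UNIV)
  moreover have "card (\<phi> ` B) = 8" using inj B(4) dim8 by (metis card_image inj_on_subset subset_UNIV)
  ultimately have "UNIV \<subseteq> span (\<phi> ` B)" by (intro card_ge_dim_independent) auto
  also have "span (\<phi> ` B) \<subseteq> range \<phi>" using \<phi> by (metis linear_span_image image_mono subset_UNIV)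
  finally obtain Y where "(a, b, c, d) = \<phi> Y" by blast
  then show ?thesis unfolding \<phi>_def by auto
qed

locale snn_structure = snn_eight +
  fixes \<omega>1 \<omega>2 \<omega>3 \<omega>4 :: "'a \<Rightarrow> complex" and A B C D E F G H K L M N P :: complex and s :: real
  assumes basis: "basis10 J \<omega>1 \<omega>2 \<omega>3 \<omega>4"
    and eqs: "structure_equations br \<omega>1 \<omega>2 \<omega>3 \<omega>4 A B C D E F G H K L M N P s"
begin

abbreviation \<eta> :: "'a \<Rightarrow> complex" where "\<eta> Y \<equiv> of_real (Im (\<omega>4 Y))"

lemma forms_are_10: "\<omega>1 \<in> forms10 J" "\<omega>2 \<in> forms10 J" "\<omega>3 \<in> forms10 J" "\<omega>4 \<in> forms10 J"
  using basis cform.span_superset[of "{\<omega>1, \<omega>2, \<omega>3, \<omega>4}"] by (auto simp: basis10_def)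

lemmas forms_linear = forms_are_10[THEN forms10_D(1)]

lemma br1: "\<omega>1 (br Y Y') = 0"
  and br2: "\<omega>2 (br Y Y') = - A * (\<omega>1 Y * cnj (\<omega>1 Y') - \<omega>1 Y' * cnj (\<omega>1 Y))
    + 2 * \<i> * B * (\<omega>1 Y * \<eta> Y' - \<omega>1 Y' * \<eta> Y)"
  and br3: "\<omega>3 (br Y Y') = - (C - D) * (\<omega>1 Y * \<omega>2 Y' - \<omega>1 Y' * \<omega>2 Y)
    + 2 * \<i> * E * (\<omega>1 Y * \<eta> Y' - \<omega>1 Y' * \<eta> Y)
    - F * (\<omega>1 Y * cnj (\<omega>1 Y') - \<omega>1 Y' * cnj (\<omega>1 Y))
    - (G + D) * (\<omega>1 Y * cnj (\<omega>2 Y') - \<omega>1 Y' * cnj (\<omega>2 Y))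
    + 2 * \<i> * H * (\<omega>2 Y * \<eta> Y' - \<omega>2 Y' * \<eta> Y)
    - (C - G) * (\<omega>2 Y * cnj (\<omega>1 Y') - \<omega>2 Y' * cnj (\<omega>1 Y))
    - K * (\<omega>2 Y * cnj (\<omega>2 Y') - \<omega>2 Y' * cnj (\<omega>2 Y))"
  and br4: "\<omega>4 (br Y Y') = - (L * (\<omega>1 Y * cnj (\<omega>1 Y') - \<omega>1 Y' * cnj (\<omega>1 Y))
    + M * (\<omega>1 Y * cnj (\<omega>2 Y') - \<omega>1 Y' * cnj (\<omega>2 Y)) + N * (\<omega>1 Y * cnj (\<omega>3 Y') - \<omega>1 Y' * cnj (\<omega>3 Y))
    - cnj M * (\<omega>2 Y * cnj (\<omega>1 Y') - \<omega>2 Y' * cnj (\<omega>1 Y))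
    + \<i> * of_real s * (\<omega>2 Y * cnj (\<omega>2 Y') - \<omega>2 Y' * cnj (\<omega>2 Y))
    + P * (\<omega>2 Y * cnj (\<omega>3 Y') - \<omega>2 Y' * cnj (\<omega>3 Y))
    - cnj N * (\<omega>3 Y * cnj (\<omega>1 Y') - \<omega>3 Y' * cnj (\<omega>1 Y))
    - cnj P * (\<omega>3 Y * cnj (\<omega>2 Y') - \<omega>3 Y' * cnj (\<omega>2 Y)))"
proof -
  have cnj4: "cnj (\<omega>4 W) = \<omega>4 W - 2 * \<i> * \<eta> W" for W
    by (simp add: complex_eq_iff)
  note e = eqs[unfolded structure_equations_def d1_def wedge_def cbar_def cnj4, rule_format, of Y Y']
  show "\<omega>1 (br Y Y') = 0" using e by simp
  show "\<omega>2 (br Y Y') = - A * (\<omega>1 Y * cnj (\<omega>1 Y') - \<omega>1 Y' * cnj (\<omega>1 Y))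
    + 2 * \<i> * B * (\<omega>1 Y * \<eta> Y' - \<omega>1 Y' * \<eta> Y)"
    using e by algebra
  show "\<omega>3 (br Y Y') = - (C - D) * (\<omega>1 Y * \<omega>2 Y' - \<omega>1 Y' * \<omega>2 Y)
    + 2 * \<i> * E * (\<omega>1 Y * \<eta> Y' - \<omega>1 Y' * \<eta> Y)
    - F * (\<omega>1 Y * cnj (\<omega>1 Y') - \<omega>1 Y' * cnj (\<omega>1 Y))
    - (G + D) * (\<omega>1 Y * cnj (\<omega>2 Y') - \<omega>1 Y' * cnj (\<omega>2 Y))
    + 2 * \<i> * H * (\<omega>2 Y * \<eta> Y' - \<omega>2 Y' * \<eta> Y)
    - (C - G) * (\<omega>2 Y * cnj (\<omega>1 Y') - \<omega>2 Y' * cnj (\<omega>1 Y))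
    - K * (\<omega>2 Y * cnj (\<omega>2 Y') - \<omega>2 Y' * cnj (\<omega>2 Y))"
    using e by algebra
  show "\<omega>4 (br Y Y') = - (L * (\<omega>1 Y * cnj (\<omega>1 Y') - \<omega>1 Y' * cnj (\<omega>1 Y))
    + M * (\<omega>1 Y * cnj (\<omega>2 Y') - \<omega>1 Y' * cnj (\<omega>2 Y)) + N * (\<omega>1 Y * cnj (\<omega>3 Y') - \<omega>1 Y' * cnj (\<omega>3 Y))
    - cnj M * (\<omega>2 Y * cnj (\<omega>1 Y') - \<omega>2 Y' * cnj (\<omega>1 Y))
    + \<i> * of_real s * (\<omega>2 Y * cnj (\<omega>2 Y') - \<omega>2 Y' * cnj (\<omega>2 Y))
    + P * (\<omega>2 Y * cnj (\<omega>3 Y') - \<omega>2 Y' * cnj (\<omega>3 Y))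
    - cnj N * (\<omega>3 Y * cnj (\<omega>1 Y') - \<omega>3 Y' * cnj (\<omega>1 Y))
    - cnj P * (\<omega>3 Y * cnj (\<omega>2 Y') - \<omega>3 Y' * cnj (\<omega>2 Y)))"
    using e by (metis minus_minus)
qed

text \<open>The terms of \<open>d \<omega>4\<close> after the first one add up to a real value, each pair being a sum of conjugates.\<close>

lemma Im_br4: "Im (\<omega>4 (br Y Y')) = - 2 * Re L * Im (\<omega>1 Y * cnj (\<omega>1 Y'))"
  unfolding br4 by (simp add: algebra_simps)

lemma eqI:
  assumes "\<omega>1 Y = \<omega>1 Y'" "\<omega>2 Y = \<omega>2 Y'" "\<omega>3 Y = \<omega>3 Y'" "\<omega>4 Y = \<omega>4 Y'"
  shows "Y = Y'"
proof -
  have "Y - Y' = 0"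
    by (rule basis10_separates[OF basis])
      (simp_all add: assms linear_diff[OF forms_linear(1)] linear_diff[OF forms_linear(2)] linear_diff[OF forms_linear(3)] linear_diff[OF forms_linear(4)])
  then show ?thesis by simp
qed

definition vector_at :: "complex \<Rightarrow> complex \<Rightarrow> complex \<Rightarrow> complex \<Rightarrow> 'a" where
  "vector_at a b c d = (SOME Y. \<omega>1 Y = a \<and> \<omega>2 Y = b \<and> \<omega>3 Y = c \<and> \<omega>4 Y = d)"

lemma vector_at [simp]: "\<omega>1 (vector_at a b c d) = a" "\<omega>2 (vector_at a b c d) = b" "\<omega>3 (vector_at a b c d) = c" "\<omega>4 (vector_at a b c d) = d"
  using someI_ex[OF basis10_coordinates[OF basis, of a b c d]] unfolding vector_at_def by auto

lemma form_scale: "\<omega>1 (r *\<^sub>R Y) = of_real r * \<omega>1 Y" "\<omega>2 (r *\<^sub>R Y) = of_real r * \<omega>2 Y"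
  "\<omega>3 (r *\<^sub>R Y) = of_real r * \<omega>3 Y" "\<omega>4 (r *\<^sub>R Y) = of_real r * \<omega>4 Y"
  by (simp_all add: linear_scale[OF forms_linear(1)] linear_scale[OF forms_linear(2)] linear_scale[OF forms_linear(3)] linear_scale[OF forms_linear(4)] scaleR_conv_of_real)

lemma form_add: "\<omega>1 (Y + Y') = \<omega>1 Y + \<omega>1 Y'" "\<omega>2 (Y + Y') = \<omega>2 Y + \<omega>2 Y'"
  "\<omega>3 (Y + Y') = \<omega>3 Y + \<omega>3 Y'" "\<omega>4 (Y + Y') = \<omega>4 Y + \<omega>4 Y'"
  by (simp_all add: linear_add[OF forms_linear(1)] linear_add[OF forms_linear(2)] linear_add[OF forms_linear(3)] linear_add[OF forms_linear(4)])

lemma form_0 [simp]: "\<omega>1 0 = 0" "\<omega>2 0 = 0" "\<omega>3 0 = 0" "\<omega>4 0 = 0"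
  by (simp_all add: linear_0[OF forms_linear(1)] linear_0[OF forms_linear(2)] linear_0[OF forms_linear(3)] linear_0[OF forms_linear(4)])

lemma g1_coords: "W \<in> g 1 \<longleftrightarrow> \<omega>1 W = 0 \<and> \<omega>2 W = 0 \<and> \<omega>3 W = 0 \<and> Im (\<omega>4 W) = 0"
proof
  assume *: "\<omega>1 W = 0 \<and> \<omega>2 W = 0 \<and> \<omega>3 W = 0 \<and> Im (\<omega>4 W) = 0"
  have "br W Y = 0" for Y by (rule eqI) (simp_all add: br1 br2 br3 br4 *)
  then show "W \<in> g 1" unfolding g1_iff by blast
next
  assume W: "W \<in> g 1"
  have "vector_at 0 0 0 1 \<in> g 1" unfolding g1_iff by (auto intro!: eqI simp: br1 br2 br3 br4)
  then obtain t where t: "vector_at 0 0 0 1 = t *\<^sub>R Z" by (rule g1E)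
  then have "t \<noteq> 0" using vector_at(4)[of 0 0 0 1] by auto
  moreover obtain r where r: "W = r *\<^sub>R Z" using W by (rule g1E)
  ultimately have "W = (r / t) *\<^sub>R vector_at 0 0 0 1" by (simp add: t)
  then show "\<omega>1 W = 0 \<and> \<omega>2 W = 0 \<and> \<omega>3 W = 0 \<and> Im (\<omega>4 W) = 0" by (simp add: form_scale)
qed

text \<open>The right-hand side clearly describes elements of \<open>g 2\<close>; equality follows from \<open>dim (g 2) = 3\<close>.\<close>

lemma g2_coordinates: "W \<in> g 2 \<longleftrightarrow> \<omega>1 W = 0 \<and> \<omega>2 W = 0 \<and> Im (\<omega>4 W) = 0"
proof
  have mem: "W \<in> g 2" if "\<omega>1 W = 0 \<and> \<omega>2 W = 0 \<and> Im (\<omega>4 W) = 0" for W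
    unfolding g2_iff g1_coords Im_br4 using that by (simp add: br1 br2 br3)
  then show "\<omega>1 W = 0 \<and> \<omega>2 W = 0 \<and> Im (\<omega>4 W) = 0 \<Longrightarrow> W \<in> g 2" .
  assume W: "W \<in> g 2"
  obtain a b c where "W = a *\<^sub>R vector_at 0 0 1 0 + b *\<^sub>R vector_at 0 0 \<i> 0 + c *\<^sub>R Z"
  proof (rule g2_basis[OF _ _ _ W])
    show "vector_at 0 0 1 0 \<in> g 2" "vector_at 0 0 \<i> 0 \<in> g 2" by (simp_all add: mem)
    fix a b c :: real assume eq: "a *\<^sub>R vector_at 0 0 1 0 + b *\<^sub>R vector_at 0 0 \<i> 0 + c *\<^sub>R Z = 0"
    have "\<omega>3 Z = 0" using g1_coords scaleR_Z_in_g1[of 1] by simp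
    then have "of_real a + of_real b * \<i> = 0"
      using arg_cong[OF eq, of \<omega>3] by (simp add: form_add form_scale)
    then have "a = 0" "b = 0" by (simp_all add: complex_eq_iff)
    then show "a = 0 \<and> b = 0 \<and> c = 0" using eq Z by simp
  qed
  moreover have "\<omega>1 Z = 0 \<and> \<omega>2 Z = 0 \<and> Im (\<omega>4 Z) = 0" using g1_coords scaleR_Z_in_g1[of 1] by simp
  ultimately show "\<omega>1 W = 0 \<and> \<omega>2 W = 0 \<and> Im (\<omega>4 W) = 0" by (simp add: form_add form_scale)
qed

lemma g3_iff: "W \<in> g 3 \<longleftrightarrow> (\<forall>Y. \<omega>2 (br W Y) = 0 \<and> Im (\<omega>4 (br W Y)) = 0)"
proof -
  have "W \<in> g 3 \<longleftrightarrow> (\<forall>Y. br W Y \<in> g 2)" by (simp add: numeral_3_eq_3 numeral_2_eq_2)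
  then show ?thesis unfolding g2_coordinates by (simp add: br1)
qed

lemma g4_iff: "W \<in> g 4 \<longleftrightarrow> (\<forall>Y. br W Y \<in> g 3)"
  by (simp add: eval_nat_numeral)

text \<open>Otherwise the vectors with only an \<open>\<omega>3\<close>-coordinate would be central.\<close>

lemma N_or_P_nonzero: "N \<noteq> 0 \<or> P \<noteq> 0"
proof (rule ccontr)
  assume "\<not> (N \<noteq> 0 \<or> P \<noteq> 0)"
  then have "vector_at 0 0 1 0 \<in> g 1" unfolding g1_iff by (auto intro!: eqI simp: br1 br2 br3 br4)
  then show False unfolding g1_coords by simp
qed

text \<open>Otherwise the vector with \<open>\<omega>4 = \<i>\<close> and no other coordinate would be central, against \<open>g1_coords\<close>.\<close>

lemma B_or_E_or_H_nonzero: "B \<noteq> 0 \<or> E \<noteq> 0 \<or> H \<noteq> 0"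
proof (rule ccontr)
  assume "\<not> (B \<noteq> 0 \<or> E \<noteq> 0 \<or> H \<noteq> 0)"
  then have "vector_at 0 0 0 \<i> \<in> g 1" unfolding g1_iff by (auto intro!: eqI simp: br1 br2 br3 br4)
  then show False unfolding g1_coords by simp
qed

text \<open>The vectors with only an \<open>\<omega>3\<close>-coordinate lie in \<open>g 2\<close> and so commute with all brackets.\<close>

lemma P_annihilates_derived: "P * \<omega>2 (br Y Y') = 0"
proof -
  have "\<omega>4 (br (vector_at 0 0 c 0) (br Y Y')) = 0" for c
    using g2_centralizes_derived[of "vector_at 0 0 c 0" Y Y'] by (simp add: g2_coordinates)
  then have *: "P * \<omega>2 (br Y Y') * cnj c + cnj P * cnj (\<omega>2 (br Y Y')) * c = 0" for c
    unfolding br4[of _ "br Y Y'"] by (simp add: br1 algebra_simps)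
  define t where "t = P * \<omega>2 (br Y Y')"
  have "t * cnj c + cnj t * c = 0" for c using *[of c] unfolding t_def by simp
  from this[of 1] this[of \<i>] have "t = 0" by (simp add: complex_eq_iff)
  then show ?thesis unfolding t_def .
qed

lemma P_zero: "A \<noteq> 0 \<or> B \<noteq> 0 \<Longrightarrow> P = 0"
proof -
  have "2 * \<i> * (P * A) = 0"
    using P_annihilates_derived[of "vector_at 1 0 0 0" "vector_at \<i> 0 0 0"] by (simp add: br2 algebra_simps)
  moreover have "2 * \<i> * (P * B) = 0"
    using P_annihilates_derived[of "vector_at 1 0 0 0" "vector_at 0 0 0 \<i>"] by (simp add: br2 algebra_simps)
  ultimately show "A \<noteq> 0 \<or> B \<noteq> 0 \<Longrightarrow> P = 0" by auto
qed

lemma jacobi_form: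
  "\<omega>3 (br X (br Y W)) + \<omega>3 (br Y (br W X)) + \<omega>3 (br W (br X Y)) = 0"
  "\<omega>4 (br X (br Y W)) + \<omega>4 (br Y (br W X)) + \<omega>4 (br W (br X Y)) = 0"
  using arg_cong[OF jacobi[of X Y W], of \<omega>3] arg_cong[OF jacobi[of X Y W], of \<omega>4] by (simp_all add: form_add)

text \<open>The coefficient of \<open>\<omega>1 \<and> \<omega>2 \<and> cbar \<omega>1\<close> in \<open>d (d \<omega>3) = 0\<close>. The Jacobi identity on vectors
  with the single coordinates \<open>\<omega>1 = 1\<close>, \<open>\<omega>1 = \<i>\<close>, \<open>\<omega>2 = y\<close> mixes it with the
  coefficient of \<open>\<omega>1 \<and> cbar \<omega>1 \<and> cbar \<omega>2\<close>, which occurs with \<open>cnj y\<close>.\<close>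

lemma relation_HL: "2 * H * of_real (Re L) + K * cnj A = 0"
proof -
  have R: "K * A * cnj y + (2 * H * of_real (Re L) + K * cnj A) * y = 0" for y
  proof -
    have "2 * \<i> * (K * A * cnj y + (2 * H * of_real (Re L) + K * cnj A) * y) = 0"
      using jacobi_form(1)[of "vector_at 1 0 0 0" "vector_at \<i> 0 0 0" "vector_at 0 y 0 0"]
      by (simp add: br3[of _ "br _ _"] br1 br2 Im_br4 algebra_simps)
    then show ?thesis by simp
  qed
  have "\<i> * (K * A * cnj 1 + (2 * H * of_real (Re L) + K * cnj A) * 1)
      + (K * A * cnj \<i> + (2 * H * of_real (Re L) + K * cnj A) * \<i>) = 0"
    by (simp only: R) simp
  then have "2 * \<i> * (2 * H * of_real (Re L) + K * cnj A) = 0" by (simp add: algebra_simps)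
  then show ?thesis by simp
qed

lemma zero_of_real_pairings:
  assumes "\<And>x. x * t = cnj (x * t)"
  shows "t = (0 :: complex)"
  using assms[of 1] assms[of \<i>] by (simp add: complex_eq_iff)

text \<open>The coefficient of \<open>\<omega>1 \<and> \<omega>2 \<and> cbar \<omega>2\<close> in \<open>d (d \<omega>4) = 0\<close>, without the terms that contain \<open>P\<close>.\<close>

lemma relation_NK: "P = 0 \<Longrightarrow> N * cnj K = 0"
proof (rule zero_of_real_pairings)
  fix x assume "P = 0"
  then show "x * (N * cnj K) = cnj (x * (N * cnj K))"
    using jacobi_form(2)[of "vector_at x 0 0 0" "vector_at 0 1 0 0" "vector_at 0 \<i> 0 0"]
    by (simp add: br4[of _ "br _ _"] br1 br2 br3 algebra_simps)
qed

text \<open>The coefficient of \<open>\<omega>1 \<and> cbar \<omega>2 \<and> Im \<omega>4\<close> in \<open>d (d \<omega>4) = 0\<close>.\<close>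

lemma relation_NH: "N * cnj H + E * cnj P = \<i> * of_real s * B"
proof -
  have "N * cnj H + E * cnj P - \<i> * of_real s * B = 0"
  proof (rule zero_of_real_pairings)
    fix x
    have "2 * \<i> * (x * (N * cnj H + E * cnj P - \<i> * of_real s * B)
        - cnj (x * (N * cnj H + E * cnj P - \<i> * of_real s * B))) = 0"
      using jacobi_form(2)[of "vector_at x 0 0 0" "vector_at 0 1 0 0" "vector_at 0 0 0 \<i>"]
      by (simp add: br4[of _ "br _ _"] br1 br2 br3 algebra_simps)
    then show "x * (N * cnj H + E * cnj P - \<i> * of_real s * B)
        = cnj (x * (N * cnj H + E * cnj P - \<i> * of_real s * B))" by simp
  qed
  then show ?thesis by simp
qed

lemma g3_if_B_nonzero: "B \<noteq> 0 \<Longrightarrow> W \<in> g 3 \<longleftrightarrow> \<omega>1 W = 0 \<and> Im (\<omega>4 W) = 0"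
proof
  assume B: "B \<noteq> 0" and W: "W \<in> g 3"
  have "2 * \<i> * B * \<omega>1 W = 0"
    using W[unfolded g3_iff, rule_format, of "vector_at 0 0 0 \<i>"] by (simp add: br2)
  then have 1: "\<omega>1 W = 0" using B by simp
  have "2 * \<i> * B * \<eta> W = 0"
    using W[unfolded g3_iff, rule_format, of "vector_at 1 0 0 0"] by (simp add: br2 1)
  then show "\<omega>1 W = 0 \<and> Im (\<omega>4 W) = 0" using B 1 by simp
next
  assume "\<omega>1 W = 0 \<and> Im (\<omega>4 W) = 0"
  then show "W \<in> g 3" unfolding g3_iff Im_br4 by (simp add: br2)
qed

lemma g3_if_B_zero: "B = 0 \<Longrightarrow> \<omega>1 W = 0 \<Longrightarrow> W \<in> g 3"
  unfolding g3_iff Im_br4 by (simp add: br2)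

lemma dim_g3_if_B_nonzero: assumes "B \<noteq> 0" shows "dim (g 3) \<le> 5"
proof -
  define f where "f = (\<lambda>(b, c, t::real). vector_at 0 b c (of_real t))"
  have "linear f"
    by (rule linearI) (auto simp: f_def form_add form_scale scaleR_conv_of_real intro!: eqI)
  moreover have "g 3 \<subseteq> range f"
  proof
    fix W assume "W \<in> g 3"
    then have "\<omega>1 W = 0" "Im (\<omega>4 W) = 0" using g3_if_B_nonzero[OF assms] by auto
    then have "W = f (\<omega>2 W, \<omega>3 W, Re (\<omega>4 W))"
      by (auto simp: f_def complex_eq_iff intro!: eqI)
    then show "W \<in> range f" by blast
  qed
  ultimately have "dim (g 3) \<le> DIM(complex \<times> complex \<times> real)" by (rule dim_le_of_linear_image)
  then show ?thesis by simp
qed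

text \<open>All vectors with \<open>\<omega>1 = 0\<close> are in \<open>g 3\<close> in this case.\<close>

lemma dim_g3_if_B_zero: assumes "B = 0" "dim (g 3) > 0" shows "dim (g 3) \<ge> 6"
proof -
  define f where "f = (\<lambda>(b, c, d). vector_at 0 b c d)"
  have "linear f"
    by (rule linearI) (auto simp: f_def form_add form_scale scaleR_conv_of_real intro!: eqI)
  moreover have "x = 0" if "f x = 0" for x
  proof -
    have "\<omega>2 (f x) = 0" "\<omega>3 (f x) = 0" "\<omega>4 (f x) = 0" using that by simp_all
    then show ?thesis by (auto simp: f_def zero_prod_def split: prod.splits)
  qed
  moreover have "range f \<subseteq> g 3" using g3_if_B_zero[OF assms(1)] by (auto simp: f_def)
  ultimately have "DIM(complex \<times> complex \<times> complex) \<le> dim (g 3)"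
    using assms(2) by (rule dim_ge_of_injective)
  then show ?thesis by simp
qed

lemma coefficients_if_g3_top:
  assumes "g 3 = UNIV" shows "A = 0" "B = 0" "Re L = 0"
proof -
  show B: "B = 0"
  proof (rule ccontr)
    assume "B \<noteq> 0"
    then have "\<omega>1 (vector_at 1 0 0 0) = 0" using g3_if_B_nonzero assms by blast
    then show False by simp
  qed
  have W: "vector_at 1 0 0 0 \<in> g 3" using assms by simp
  have "2 * \<i> * A = 0"
    using W[unfolded g3_iff, rule_format, of "vector_at \<i> 0 0 0"] by (simp add: br2 algebra_simps)
  then show "A = 0" by simp
  show "Re L = 0"
    using W[unfolded g3_iff, rule_format, of "vector_at \<i> 0 0 0"] by (simp add: Im_br4)
qed

lemma dim_pos: "dim (UNIV :: 'a set) > 0" using dim8 by simp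

lemma ascending_type_138:
  assumes "ascending_type br = [1, 3, 8]" shows "A = 0" "B = 0" "Re L = 0"
  using ascending_type_nth(1)[OF assms dim_pos] coefficients_if_g3_top by (simp_all add: eval_nat_numeral)

lemma Re_L_if_g4_top: assumes "g 4 = UNIV" "B \<noteq> 0" shows "Re L = 0"
proof -
  have "br (vector_at 1 0 0 0) (vector_at \<i> 0 0 0) \<in> g 3" using assms(1) g4_iff by blast
  then have "Im (\<omega>4 (br (vector_at 1 0 0 0) (vector_at \<i> 0 0 0))) = 0" using g3_if_B_nonzero[OF assms(2)] by blast
  then show ?thesis by (simp add: Im_br4)
qed

text \<open>A third dimension of six excludes \<open>B \<noteq> 0\<close>. If \<open>A = 0\<close>, then \<open>Re L \<noteq> 0\<close>, as otherwise \<open>g 3\<close> would be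
  everything; so \<open>H = 0\<close> by \<open>relation_HL\<close>, \<open>E\<close> is the only one of \<open>B\<close>, \<open>E\<close>, \<open>H\<close> left to be nonzero, and
  \<open>relation_NH\<close> gives \<open>P = 0\<close>. If \<open>A \<noteq> 0\<close>, then \<open>P = 0\<close> at once, \<open>N\<close> must be nonzero, and the same
  relation gives \<open>H = 0\<close>.\<close>

lemma ascending_type_1368:
  assumes t: "ascending_type br = [1, 3, 6, 8]" shows "B = 0 \<and> H = 0 \<and> K = 0 \<and> P = 0"
proof -
  have d: "dim (g 3) = 6" using ascending_type_nth(2)[OF t dim_pos, of 2] by (simp add: eval_nat_numeral)
  have B: "B = 0" using dim_g3_if_B_nonzero d by fastforce
  have HP: "H = 0 \<and> P = 0"
  proof (cases "A = 0")
    case True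
    have "Re L \<noteq> 0"
    proof
      assume "Re L = 0"
      then have "g 3 = UNIV" using True B by (auto simp: g3_iff br2 Im_br4)
      then show False using d dim8 by simp
    qed
    then have H: "H = 0" using relation_HL True by simp
    then have "E \<noteq> 0" using B_or_E_or_H_nonzero B by simp
    then show ?thesis using relation_NH B H by simp
  next
    case False
    then have P: "P = 0" by (simp add: P_zero)
    then show ?thesis using relation_NH B N_or_P_nonzero by simp
  qed
  then have "N * cnj K = 0" "N \<noteq> 0" using relation_NK N_or_P_nonzero by auto
  then show ?thesis using B HP by simp
qed

lemma coefficients_if_dim_g3_5:
  assumes d: "dim (g 3) = 5" shows "B \<noteq> 0" "K = 0" "P = 0"
proof -
  show B: "B \<noteq> 0" using dim_g3_if_B_zero d by fastforce
  show P: "P = 0" using P_zero B by blast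
  show "K = 0" using relation_NK[OF P] N_or_P_nonzero P by simp
qed

lemma ascending_type_1358:
  assumes t: "ascending_type br = [1, 3, 5, 8]" shows "K = 0 \<and> P = 0 \<and> Re L = 0"
proof -
  have d: "dim (g 3) = 5" using ascending_type_nth(2)[OF t dim_pos, of 2] by (simp add: eval_nat_numeral)
  have "g 4 = UNIV" using ascending_type_nth(1)[OF t dim_pos] by (simp add: eval_nat_numeral)
  then show ?thesis using Re_L_if_g4_top coefficients_if_dim_g3_5[OF d] by blast
qed

text \<open>With \<open>B \<noteq> 0\<close>, the equation \<open>Re L = 0\<close> would put all brackets into \<open>g 3\<close> and make \<open>g 4\<close> everything.\<close>

lemma ascending_type_13568:
  assumes t: "ascending_type br = [1, 3, 5, 6, 8]"
  shows "H = 0 \<and> K = 0 \<and> P = 0 \<and> s = 0 \<and> Re L \<noteq> 0"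
proof -
  have d: "dim (g 3) = 5" using ascending_type_nth(2)[OF t dim_pos, of 2] by (simp add: eval_nat_numeral)
  have d4: "dim (g 4) = 6" using ascending_type_nth(2)[OF t dim_pos, of 3] by (simp add: eval_nat_numeral)
  note BKP = coefficients_if_dim_g3_5[OF d]
  have L: "Re L \<noteq> 0"
  proof
    assume "Re L = 0"
    then have "br W Y \<in> g 3" for W Y unfolding g3_if_B_nonzero[OF BKP(1)] by (simp add: br1 Im_br4)
    then have "g 4 = UNIV" using g4_iff by blast
    then show False using d4 dim8 by simp
  qed
  then have H: "H = 0" using relation_HL BKP by simp
  then have "s = 0" using relation_NH BKP by simp
  then show ?thesis using H BKP L by simp
qed

end

theorem proposition4p12:
  fixes br :: "'a::real_vector \<Rightarrow> 'a \<Rightarrow> 'a" and J :: "'a \<Rightarrow> 'a"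
  assumes "lie_algebra br" and "dim (UNIV :: 'a set) = 8" and "nilpotent_lie br"
    and "SnN br J"
    and "dim (asc_series br 1) = 1" and "dim (asc_series br 2) = 3"
  shows "(\<exists>\<omega>1 \<omega>2 \<omega>3 \<omega>4 A B C D E F G H K L M N P s.
            basis10 J \<omega>1 \<omega>2 \<omega>3 \<omega>4 \<and>
            structure_equations br \<omega>1 \<omega>2 \<omega>3 \<omega>4 A B C D E F G H K L M N P s \<and>
            (\<forall>\<omega>\<in>{\<omega>1, \<omega>2, \<omega>3, \<omega>4}. \<forall>X Y Z. d2 br (d1 br \<omega>) X Y Z = 0)) \<and>
         (\<forall>\<omega>1 \<omega>2 \<omega>3 \<omega>4 A B C D E F G H K L M N P s.
            basis10 J \<omega>1 \<omega>2 \<omega>3 \<omega>4 \<longrightarrow>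
            structure_equations br \<omega>1 \<omega>2 \<omega>3 \<omega>4 A B C D E F G H K L M N P s \<longrightarrow>
            (ascending_type br = [1, 3, 8] \<longrightarrow> A = 0 \<and> B = 0 \<and> Re L = 0) \<and>
            (ascending_type br = [1, 3, 6, 8] \<longrightarrow> B = 0 \<and> H = 0 \<and> K = 0 \<and> P = 0) \<and>
            (ascending_type br = [1, 3, 5, 8] \<longrightarrow> K = 0 \<and> P = 0 \<and> Re L = 0) \<and>
            (ascending_type br = [1, 3, 5, 6, 8] \<longrightarrow>
               H = 0 \<and> K = 0 \<and> P = 0 \<and> s = 0 \<and> Re L \<noteq> 0))"
proof -
  interpret nilpotent_complex_lie_algebra br J
    using assms by unfold_locales (auto simp: SnN_def)
  obtain Z where Z: "Z \<in> g 1" "Z \<noteq> 0"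
  proof -
    have "\<not> g 1 \<subseteq> {0}"
    proof
      assume "g 1 \<subseteq> {0}"
      then have "dim (g 1) \<le> card ({} :: 'a set)" by (intro dim_le_card) auto
      then show False using assms(5) by simp
    qed
    then show ?thesis using that by blast
  qed
  have "g 1 \<subseteq> range (\<lambda>t. t *\<^sub>R Z)"
  proof (rule linear_injective_onto_subspace[OF _ _ g_subspace])
    show "linear (\<lambda>t. t *\<^sub>R Z)" by (rule linearI) (simp_all add: scaleR_add_left)
    show "range (\<lambda>t. t *\<^sub>R Z) \<subseteq> g 1" using g_closed(4)[OF Z(1)] by blast
  qed (use Z(2) assms(5) in auto)
  moreover have "range (\<lambda>t. t *\<^sub>R Z) \<subseteq> g 1" using g_closed(4)[OF Z(1)] by blast
  ultimately interpret snn_eight br J Z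
    using assms Z(2) by unfold_locales (auto simp: SnN_def)
  obtain X where X: "X \<in> g 2" "J X \<in> g 2" "X \<noteq> 0" using g2_meets_J_g2 by blast
  obtain V1 V2 where "adapted X V1 V2"
    using adapted_T_into_M[OF X] adapted_T_not_into_M[OF X] by blast
  then obtain \<omega>1 \<omega>2 \<omega>3 \<omega>4 A B C D E F G H K L M N P s where
    basis: "basis10 J \<omega>1 \<omega>2 \<omega>3 \<omega>4" and
    eqs: "structure_equations br \<omega>1 \<omega>2 \<omega>3 \<omega>4 A B C D E F G H K L M N P s"
    by (rule structure_equations_of_adapted[OF X])
  have "{\<omega>1, \<omega>2, \<omega>3, \<omega>4} \<subseteq> forms10 J"
    using basis cform.span_superset[of "{\<omega>1, \<omega>2, \<omega>3, \<omega>4}"] by (simp add: basis10_def)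
  then have d2: "d2 br (d1 br \<omega>) X Y W = 0" if "\<omega> \<in> {\<omega>1, \<omega>2, \<omega>3, \<omega>4}" for \<omega> X Y W
    using that forms10_D(1) d2_d1_zero by blast
  have types: "(ascending_type br = [1, 3, 8] \<longrightarrow> A = 0 \<and> B = 0 \<and> Re L = 0) \<and>
            (ascending_type br = [1, 3, 6, 8] \<longrightarrow> B = 0 \<and> H = 0 \<and> K = 0 \<and> P = 0) \<and>
            (ascending_type br = [1, 3, 5, 8] \<longrightarrow> K = 0 \<and> P = 0 \<and> Re L = 0) \<and>
            (ascending_type br = [1, 3, 5, 6, 8] \<longrightarrow>
               H = 0 \<and> K = 0 \<and> P = 0 \<and> s = 0 \<and> Re L \<noteq> 0)"
    if "basis10 J \<omega>1 \<omega>2 \<omega>3 \<omega>4"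
      "structure_equations br \<omega>1 \<omega>2 \<omega>3 \<omega>4 A B C D E F G H K L M N P s"
    for \<omega>1 \<omega>2 \<omega>3 \<omega>4 A B C D E F G H K L M N P s
  proof -
    interpret snn_structure br J Z \<omega>1 \<omega>2 \<omega>3 \<omega>4 A B C D E F G H K L M N P s
      using that by unfold_locales
    show ?thesis using ascending_type_138 ascending_type_1368 ascending_type_1358 ascending_type_13568 by blast
  qed
  show ?thesis
  proof (rule conjI, goal_cases)
    case 1
    show ?case by (intro exI conjI ballI allI, rule basis, rule eqs, rule d2)
  next
    case 2
    show ?case by (intro allI impI, rule types)
  qed
qed

end
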